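(* Let $q,p\colon\mathbb{R}\to\mathbb{R}$ be bounded and uniformly continuous, and for $\lambda\in\mathbb{R}$ consider the equation $$x'=-x^2+q(t)\,x+p(t)+\lambda.\qquad( * )_\lambda$$ There exists a unique $\lambda^*=\lambda^*(q,p)\in[-\|q^2/4+p\|,\|p\|]$ such that: (i) $\mathcal{B}_\lambda$ is empty if and only if $\lambda<\lambda^*$. (ii) If $\lambda^*\le\lambda_1<\lambda_2$, then $\mathcal{B}_{\lambda_1}\subsetneq\mathcal{B}_{\lambda_2}$. More precisely, $r_{\lambda_2}<r_{\lambda_1}\le a_{\lambda_1}<a_{\lambda_2}$ (pointwise on $\mathbb{R}$). In addition, $\lim_{\lambda\to\infty}a_\lambda(t)=\infty$ and $\lim_{\lambda\to\infty}r_\lambda(t)=-\infty$ uniformly on $\mathbb{R}$. (iii) If $\lambda=\lambda^*$, then $\inf_{t\in\mathbb{R}}(a_{\lambda^*}(t)-r_{\lambda^*}(t))=0$, and $( * )_{\lambda^*}$ has no hyperbolic solutions. (iv) If $\lambda>\lambda^*$, then $a_\lambda$ and $r_\lambda$ are uniformly separated, i.e. $\inf_{t\in\mathbb{R}}(a_\lambda(t)-r_\lambda(t))>0$, and they are the unique hyperbolic solutions of $( * )_\lambda$. The asymptotic dynamics of $( * )_\lambda$ is as follows: $a_\lambda$ is attractive and $r_\lambda$ is repulsive; $x_\lambda(t,s,x_0)$ is bounded for $t\to-\infty$ if and only if $x_0\le a_\lambda(s)$, and bounded for $t\to\infty$ if and only if $x_0\ge r_\lambda(s)$; $a_\lambda,r_\lambda$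 are the unique bounded solutions which are uniformly separated; and if $(k_a,\beta_a)$, $(k_r,\beta_r)$ are dichotomy constant pairs for $a_\lambda$, $r_\lambda$, and $\bar\beta_a\in(0,\beta_a)$, $\bar\beta_r\in(0,\beta_r)$, then for every $\varepsilon>0$ there are $k_{a,\varepsilon},k_{r,\varepsilon}\ge1$ with $$|a_\lambda(t)-x_\lambda(t,s,x_0)|\le k_{a,\varepsilon}e^{-\bar\beta_a(t-s)}|a_\lambda(s)-x_0|\ \text{ if } x_0\ge r_\lambda(s)+\varepsilon,\ t\ge s,$$ $$|r_\lambda(t)-x_\lambda(t,s,x_0)|\le k_{r,\varepsilon}e^{\bar\beta_r(t-s)}|r_\lambda(s)-x_0|\ \text{ if } x_0\le a_\lambda(s)-\varepsilon,\ t\le s,$$ and moreover $$|a_\lambda(t)-x_\lambda(t,s,x_0)|\le k_a e^{-\beta_a(t-s)}|a_\lambda(s)-x_0|\ \text{ if } x_0\ge a_\lambda(s),\ t\ge s,$$ $$|r_\lambda(t)-x_\lambda(t,s,x_0)|\le k_r e^{\beta_r(t-s)}|r_\lambda(s)-x_0|\ \text{ if } x_0\le r_\lambda(s),\ t\le s.$$ (v) $\lambda^*(q,p+\lambda)=\lambda^*(q,p)-\lambda$ for any $\lambda\in\mathbb{R}$.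
   Context: $\|b\|:=\sup_{t\in\mathbb{R}}|b(t)|$. The function $t\mapsto x_\lambda(t,s,x_0)$ is the maximal solution of $( * )_\lambda$ with value $x_0$ at $t=s$. $\mathcal{B}_\lambda$ is the (possibly empty) set of pairs $(s,x_0)\in\mathbb{R}^2$ for which $x_\lambda(\cdot,s,x_0)$ is globally defined and bounded. "Bounded for $t\to-\infty$" (resp. $t\to\infty$) means defined and bounded on $(-\infty,s]$ (resp. $[s,\infty)$). $a_\lambda(s)$ is the maximum of the set of $x_0$ such that $x_\lambda(\cdot,s,x_0)$ is bounded above on the part of its maximal interval to the left of $s$, and $r_\lambda(s)$ is the minimum of the set of $x_0$ such that $x_\lambda(\cdot,s,x_0)$ is bounded below on the part of its maximal interval to the right of $s$, at those $s$ where these sets are nonempty. When $\mathcal{B}_\lambda\ne\emptyset$, $a_\lambda$ and $r_\lambda$ are globally defined bounded solutions of $( * )_\lambda$ and $\mathcal{B}_\lambda=\{(s,x_0): r_\lambda(s)\le x_0\le a_\lambda(s)\}$. A globally defined solution $\tilde b$ of $( * )_\lambda$ is hyperbolic if there are $k\ge1$, $\beta>0$ such that either $\exp\int_s^t(-2\tilde b(l)+q(l))\,dl\le k\,e^{-\beta(t-s)}$ whenever $t\ge s$ (attractive), or $\exp\int_s^t(-2\tilde b(l)+q(l))\,dl\le k\,e^{\beta(t-s)}$ whenever $t\le s$ (repulsive); $(k,\beta)$ is then a dichotomy constant pair for $\tilde b$. *)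

theory Defs
  imports "HOL-Analysis.Analysis"
begin

definition sup_norm :: "(real \<Rightarrow> real) \<Rightarrow> real" where
  "sup_norm b = (SUP t. \<bar>b t\<bar>)"

definition solves_on ::
  "(real \<Rightarrow> real) \<Rightarrow> (real \<Rightarrow> real) \<Rightarrow> real \<Rightarrow> real set \<Rightarrow> (real \<Rightarrow> real) \<Rightarrow> bool" where
  "solves_on q p lam I x \<longleftrightarrow> open I \<and> is_interval I \<and>
     (\<forall>t\<in>I. (x has_real_derivative - (x t)\<^sup>2 + q t * x t + p t + lam) (at t))"

text \<open>The maximal solution with value \<open>x0\<close> at \<open>s\<close> is the common extension of all solutions on
  open intervals around \<open>s\<close>. Its domain is \<open>max_interval q p lam s x0\<close>;
  outside that domain \<open>flow q p lam t s x0\<close> has no meaning.\<close>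

definition max_interval ::
  "(real \<Rightarrow> real) \<Rightarrow> (real \<Rightarrow> real) \<Rightarrow> real \<Rightarrow> real \<Rightarrow> real \<Rightarrow> real set" where
  "max_interval q p lam s x0 = \<Union>{I. s \<in> I \<and> (\<exists>x. solves_on q p lam I x \<and> x s = x0)}"

definition flow ::
  "(real \<Rightarrow> real) \<Rightarrow> (real \<Rightarrow> real) \<Rightarrow> real \<Rightarrow> real \<Rightarrow> real \<Rightarrow> real \<Rightarrow> real" where
  "flow q p lam t s x0 =
     (THE y. \<exists>I x. solves_on q p lam I x \<and> s \<in> I \<and> t \<in> I \<and> x s = x0 \<and> x t = y)"

definition bounded_orbits ::
  "(real \<Rightarrow> real) \<Rightarrow> (real \<Rightarrow> real) \<Rightarrow> real \<Rightarrow> (real \<times> real) set" where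
  "bounded_orbits q p lam =
     {(s, x0). max_interval q p lam s x0 = UNIV \<and> bounded (range (\<lambda>t. flow q p lam t s x0))}"

definition bounded_past ::
  "(real \<Rightarrow> real) \<Rightarrow> (real \<Rightarrow> real) \<Rightarrow> real \<Rightarrow> real \<Rightarrow> real \<Rightarrow> bool" where
  "bounded_past q p lam s x0 \<longleftrightarrow>
     {..s} \<subseteq> max_interval q p lam s x0 \<and> bounded ((\<lambda>t. flow q p lam t s x0) ` {..s})"

definition bounded_future ::
  "(real \<Rightarrow> real) \<Rightarrow> (real \<Rightarrow> real) \<Rightarrow> real \<Rightarrow> real \<Rightarrow> real \<Rightarrow> bool" where
  "bounded_future q p lam s x0 \<longleftrightarrow>
     {s..} \<subseteq> max_interval q p lam s x0 \<and> bounded ((\<lambda>t. flow q p lam t s x0) ` {s..})"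

text \<open>\<open>upper_sol\<close> and \<open>lower_sol\<close> are the functions usually written $a_\lambda$ and $r_\lambda$;
  they are meaningful only at those \<open>s\<close> where the maximum, respectively the minimum, exists.\<close>

definition upper_sol :: "(real \<Rightarrow> real) \<Rightarrow> (real \<Rightarrow> real) \<Rightarrow> real \<Rightarrow> real \<Rightarrow> real" where
  "upper_sol q p lam s = (GREATEST x0.
     bdd_above ((\<lambda>t. flow q p lam t s x0) ` (max_interval q p lam s x0 \<inter> {..s})))"

definition lower_sol :: "(real \<Rightarrow> real) \<Rightarrow> (real \<Rightarrow> real) \<Rightarrow> real \<Rightarrow> real \<Rightarrow> real" where
  "lower_sol q p lam s = (LEAST x0.
     bdd_below ((\<lambda>t. flow q p lam t s x0) ` (max_interval q p lam s x0 \<inter> {s..})))"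

definition global_solution ::
  "(real \<Rightarrow> real) \<Rightarrow> (real \<Rightarrow> real) \<Rightarrow> real \<Rightarrow> (real \<Rightarrow> real) \<Rightarrow> bool" where
  "global_solution q p lam b \<longleftrightarrow> solves_on q p lam UNIV b"

definition bounded_solution ::
  "(real \<Rightarrow> real) \<Rightarrow> (real \<Rightarrow> real) \<Rightarrow> real \<Rightarrow> (real \<Rightarrow> real) \<Rightarrow> bool" where
  "bounded_solution q p lam b \<longleftrightarrow> global_solution q p lam b \<and> bounded (range b)"

definition uniformly_separated :: "(real \<Rightarrow> real) \<Rightarrow> (real \<Rightarrow> real) \<Rightarrow> bool" where
  "uniformly_separated x y \<longleftrightarrow> (INF t. \<bar>x t - y t\<bar>) > 0"

text \<open>The interval integral is oriented, as needed in the repulsive case, where \<open>t \<le> s\<close>.\<close>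

definition attractive_pair :: "(real \<Rightarrow> real) \<Rightarrow> (real \<Rightarrow> real) \<Rightarrow> real \<Rightarrow> real \<Rightarrow> bool" where
  "attractive_pair q b k \<beta> \<longleftrightarrow> k \<ge> 1 \<and> \<beta> > 0 \<and>
     (\<forall>s t. t \<ge> s \<longrightarrow>
        exp (LBINT l=ereal s..ereal t. - 2 * b l + q l) \<le> k * exp (- \<beta> * (t - s)))"

definition repulsive_pair :: "(real \<Rightarrow> real) \<Rightarrow> (real \<Rightarrow> real) \<Rightarrow> real \<Rightarrow> real \<Rightarrow> bool" where
  "repulsive_pair q b k \<beta> \<longleftrightarrow> k \<ge> 1 \<and> \<beta> > 0 \<and>
     (\<forall>s t. t \<le> s \<longrightarrow>
        exp (LBINT l=ereal s..ereal t. - 2 * b l + q l) \<le> k * exp (\<beta> * (t - s)))"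

definition dichotomy_pair :: "(real \<Rightarrow> real) \<Rightarrow> (real \<Rightarrow> real) \<Rightarrow> real \<Rightarrow> real \<Rightarrow> bool" where
  "dichotomy_pair q b k \<beta> \<longleftrightarrow> attractive_pair q b k \<beta> \<or> repulsive_pair q b k \<beta>"

definition hyperbolic ::
  "(real \<Rightarrow> real) \<Rightarrow> (real \<Rightarrow> real) \<Rightarrow> real \<Rightarrow> (real \<Rightarrow> real) \<Rightarrow> bool" where
  "hyperbolic q p lam b \<longleftrightarrow> global_solution q p lam b \<and> (\<exists>k \<beta>. dichotomy_pair q b k \<beta>)"

definition attractive_hyperbolic ::
  "(real \<Rightarrow> real) \<Rightarrow> (real \<Rightarrow> real) \<Rightarrow> real \<Rightarrow> (real \<Rightarrow> real) \<Rightarrow> bool" where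
  "attractive_hyperbolic q p lam b \<longleftrightarrow>
     global_solution q p lam b \<and> (\<exists>k \<beta>. attractive_pair q b k \<beta>)"

definition repulsive_hyperbolic ::
  "(real \<Rightarrow> real) \<Rightarrow> (real \<Rightarrow> real) \<Rightarrow> real \<Rightarrow> (real \<Rightarrow> real) \<Rightarrow> bool" where
  "repulsive_hyperbolic q p lam b \<longleftrightarrow>
     global_solution q p lam b \<and> (\<exists>k \<beta>. repulsive_pair q b k \<beta>)"

text \<open>The number $\lambda^*(q,p)$. The condition below has at most one solution \<open>L\<close>, for any \<open>q\<close>
  and \<open>p\<close>: if \<open>L < L'\<close> were two of them, \<open>lam = L\<close> would contradict it.\<close>

definition lambda_star :: "(real \<Rightarrow> real) \<Rightarrow> (real \<Rightarrow> real) \<Rightarrow> real" where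
  "lambda_star q p = (THE L. \<forall>lam. bounded_orbits q p lam = {} \<longleftrightarrow> lam < L)"

end

theory Submission
  imports Defs
begin

text \<open>
Three elementary facts carry the proof.

\<^bold>\<open>Existence from a lower solution.\<close> A global solution is bounded by a constant depending only on
\<open>q\<close>, \<open>p\<close> and \<open>lam\<close>, because large positive values blow up in backward time and large negative ones in
forward time. Adding \<open>c x\<close> to both sides, with \<open>c\<close> large, turns the equation into \<open>x' + c x = G x t\<close>
with \<open>G\<close> increasing in \<open>x\<close> on the relevant range. Solving the linear equation for its bounded solution
is then a monotone operation, and iterating it from a large constant gives a decreasing sequence whose
limit is a global solution. It lies above every bounded differentiable function \<open>w\<close> with \<open>w' \<le> -w\<^sup>2 + q w + p + lam\<close>,
hence above every global solution (\<open>maximal_solution_above_lower_solution\<close>). All existence questions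
thus become constructions of lower solutions. For the set of admissible parameters: it contains
every \<open>lam\<close> with \<open>p + lam \<ge> 0\<close>, with lower solution \<open>0\<close>; it is closed upwards, as a solution for a
smaller parameter is a lower solution for a larger one; and it contains its infimum \<open>\<lambda>\<^sup>*\<close>, by a limit
argument (\<open>solution_at_infimum\<close>).

\<^bold>\<open>One solution determines the others.\<close> If \<open>b\<close> is a global solution and \<open>H' = q - 2 b\<close>, \<open>W' = exp H\<close>,
then every other solution is \<open>b + k exp H / (1 + k (W - W s))\<close>, on the interval where the denominator is
positive. This explicit formula identifies \<open>a\<close>, the largest initial value whose past is bounded above,
with the maximal global solution, and it gives all the convergence rates in the
hyperbolic case, with the exponent of the dichotomy itself.

\<^bold>\<open>The difference of two solutions.\<close> If \<open>d = a - r\<close>, then \<open>d' / d = q - 2 a + d = q - 2 r - d\<close>. So if \<open>d\<close>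
is bounded away from zero, \<open>a\<close> is attractive and \<open>r\<close> is repulsive with exponent \<open>inf d\<close>. For
\<open>lam > \<lambda>\<^sup>*\<close> the difference is bounded away from zero, because a solution for the parameter \<open>\<lambda>\<^sup>*\<close> lies
between \<open>r\<close> and \<open>a\<close> with a definite distance. At \<open>lam = \<lambda>\<^sup>*\<close> it is not: if \<open>d \<ge> \<delta> > 0\<close>, then
\<open>(a + r) / 2\<close> would be a lower solution for the parameter \<open>\<lambda>\<^sup>* - \<delta>\<^sup>2 / 4\<close>. For the same reason there is no
hyperbolic solution at \<open>\<lambda>\<^sup>*\<close>: if \<open>b\<close> were an attractive one, a small perturbation \<open>b - \<rho> h\<close>, with \<open>h\<close> bounded and
\<open>h' \<ge> (q - 2 b) h + 1 / 2\<close>, would again be a lower solution for a smaller parameter.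

Most statements about \<open>r\<close> follow from those about \<open>a\<close> by the time reversal \<open>x \<mapsto> -x(-t)\<close>, which replaces
\<open>q(t)\<close>, \<open>p(t)\<close> by \<open>-q(-t)\<close>, \<open>p(-t)\<close> and exchanges attraction with repulsion.
\<close>

section \<open>Real functions and scalar differential inequalities\<close>

lemma abs_le_sup_norm:
  assumes "bounded (range b)"
  shows "\<bar>b t\<bar> \<le> sup_norm b"
proof -
  obtain K where "\<And>t. \<bar>b t\<bar> \<le> K"
    using assms by (auto simp: bounded_iff)
  then show ?thesis
    unfolding sup_norm_def by (intro cSUP_upper bdd_aboveI2[where M = K]) auto
qed

lemma antiderivative_exists:
  fixes f :: "real \<Rightarrow> real"
  assumes "continuous_on UNIV f"
  obtains F where "\<And>t. (F has_real_derivative f t) (at t)"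
proof -
  have "\<exists>F. \<forall>x. - \<infinity> < ereal x \<longrightarrow> ereal x < \<infinity> \<longrightarrow> (F has_vector_derivative f x) (at x)"
    by (rule einterval_antiderivative) (use assms in \<open>auto simp: continuous_on_eq_continuous_at\<close>)
  then show thesis
    using that by (auto simp: has_real_derivative_iff_has_vector_derivative)
qed

lemma continuous_on_of_derivative:
  fixes f :: "real \<Rightarrow> real"
  assumes "\<And>t. (f has_real_derivative f' t) (at t)"
  shows "continuous_on A f"
  using assms by (meson DERIV_isCont continuous_at_imp_continuous_on)

lemma stays_nonpositive:
  fixes f f' :: "real \<Rightarrow> real"
  assumes "a \<le> b"
    and deriv: "\<And>t. t \<in> {a..b} \<Longrightarrow> (f has_real_derivative f' t) (at t)"
    and start: "f a \<le> 0"
    and down: "\<And>t. t \<in> {a..b} \<Longrightarrow> f t > 0 \<Longrightarrow> f' t \<le> 0"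
  shows "f b \<le> 0"
proof (rule ccontr)
  assume pos: "\<not> f b \<le> 0"
  define S where "S = {a..b} \<inter> f -` {..0}"
  have cont: "continuous_on {a..b} f"
    using deriv by (meson DERIV_isCont continuous_at_imp_continuous_on)
  have "closed S"
    unfolding S_def by (intro continuous_closed_preimage cont) auto
  then have "compact S"
    by (metis S_def compact_Icc closed_Int_compact inf.idem inf_assoc inf_commute)
  moreover have "a \<in> S"
    using assms by (auto simp: S_def)
  \<comment> \<open>the last time at which \<open>f\<close> is not positive, after which it cannot increase\<close>
  ultimately obtain s where s: "s \<in> S" "\<And>t. t \<in> S \<Longrightarrow> t \<le> s"
    using compact_attains_sup[of S] by auto
  then have "s < b"
    using pos by (cases "s = b") (auto simp: S_def)
  then obtain z where z: "s < z" "z < b" "f b - f s = (b - s) * f' z"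
    using MVT2[of s b f f'] deriv s(1) by (auto simp: S_def)
  then have "z \<notin> S" using s(2)[of z] by auto
  then have "f z > 0"
    using z s(1) \<open>s < b\<close> by (auto simp: S_def)
  then have "f' z \<le> 0"
    using down[of z] z s(1) by (auto simp: S_def)
  then have "(b - s) * f' z \<le> 0"
    using \<open>s < b\<close> by (simp add: mult_le_0_iff)
  then show False
    using z pos s(1) by (auto simp: S_def)
qed

text \<open>The comparison principle used throughout. The quantity \<open>(d - \<delta> / c) exp (c t)\<close> is nondecreasing, and as
\<open>d\<close> is bounded below, its limit at \<open>-\<infinity>\<close> is not negative.\<close>

lemma linear_differential_lower_bound:
  fixes d d' :: "real \<Rightarrow> real"
  assumes deriv: "\<And>t. (d has_real_derivative d' t) (at t)"
    and ineq: "\<And>t. d' t \<ge> - c * d t + \<delta>"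
    and below: "\<And>t. m \<le> d t"
    and "c > 0"
  shows "\<delta> / c \<le> d t"
proof -
  define \<phi> where "\<phi> u = (d u - \<delta> / c) * exp (c * u)" for u
  have mono: "\<phi> u \<le> \<phi> v" if "u \<le> v" for u v
  proof (rule DERIV_nonneg_imp_nondecreasing[OF that])
    fix z
    have "(\<phi> has_real_derivative (d' z + c * d z - \<delta>) * exp (c * z)) (at z)"
      unfolding \<phi>_def using \<open>c > 0\<close>
      by (auto intro!: derivative_eq_intros deriv simp: field_simps)
    moreover have "(d' z + c * d z - \<delta>) * exp (c * z) \<ge> 0"
      using ineq[of z] by simp
    ultimately show "\<exists>y. (\<phi> has_real_derivative y) (at z) \<and> 0 \<le> y" by blast
  qed
  have "((\<lambda>u. (m - \<delta> / c) * exp (c * u)) \<longlongrightarrow> (m - \<delta> / c) * 0) at_bot"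
    by (intro tendsto_mult tendsto_const filterlim_compose[OF exp_at_bot]
        filterlim_tendsto_pos_mult_at_bot[OF tendsto_const \<open>c > 0\<close>] filterlim_ident)
  then have "((\<lambda>u. (m - \<delta> / c) * exp (c * u)) \<longlongrightarrow> 0) at_bot" by simp
  moreover have "eventually (\<lambda>u. (m - \<delta> / c) * exp (c * u) \<le> \<phi> t) at_bot"
  proof (rule eventually_mono[OF eventually_le_at_bot[of t]])
    fix u assume "u \<le> t"
    have "(m - \<delta> / c) * exp (c * u) \<le> \<phi> u"
      unfolding \<phi>_def using below[of u] by simp
    then show "(m - \<delta> / c) * exp (c * u) \<le> \<phi> t"
      using mono[OF \<open>u \<le> t\<close>] by simp
  qed
  ultimately have "0 \<le> \<phi> t"
    by (intro tendsto_upperbound[where F = at_bot]) auto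
  then show ?thesis
    by (simp add: \<phi>_def zero_le_mult_iff)
qed

text \<open>The bounded solution is \<open>g t = exp (- c t) \<integral> exp (c u) G u du\<close> over \<open>{..t}\<close>. To avoid improper integrals, \<open>G\<close>
is shifted to \<open>G + K \<ge> 0\<close>: an antiderivative \<open>A\<close> of the integrand is then nondecreasing and bounded
below, and its infimum is its limit at \<open>-\<infinity>\<close>.\<close>

lemma linear_bounded_solution:
  fixes G :: "real \<Rightarrow> real"
  assumes cont: "continuous_on UNIV G" and bound: "\<And>t. \<bar>G t\<bar> \<le> K" and "c > 0"
  obtains g where "\<And>t. (g has_real_derivative - c * g t + G t) (at t)" "\<And>t. \<bar>g t\<bar> \<le> K / c"
proof -
  have "continuous_on UNIV (\<lambda>t. exp (c * t) * (G t + K))"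
    by (intro continuous_intros cont)
  then obtain A where A: "\<And>t. (A has_real_derivative exp (c * t) * (G t + K)) (at t)"
    by (rule antiderivative_exists) blast
  have mono: "A u \<le> A v" if "u \<le> v" for u v
  proof (rule DERIV_nonneg_imp_nondecreasing[OF that])
    fix z
    have "exp (c * z) * (G z + K) \<ge> 0"
      using bound[of z] by simp
    then show "\<exists>y. (A has_real_derivative y) (at z) \<and> 0 \<le> y" using A by blast
  qed
  have anti: "A v - 2 * K / c * exp (c * v) \<le> A u - 2 * K / c * exp (c * u)" if "u \<le> v" for u v
  proof (rule DERIV_nonpos_imp_nonincreasing[OF that])
    fix z
    have "((\<lambda>u. A u - 2 * K / c * exp (c * u)) has_real_derivative exp (c * z) * (G z - K)) (at z)"
      using \<open>c > 0\<close> by (auto intro!: derivative_eq_intros A simp: field_simps)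
    moreover have "exp (c * z) * (G z - K) \<le> 0"
      using bound[of z] by (simp add: mult_le_0_iff)
    ultimately show "\<exists>y. ((\<lambda>u. A u - 2 * K / c * exp (c * u)) has_real_derivative y) (at z) \<and> y \<le> 0"
      by blast
  qed
  have K: "K \<ge> 0" using bound[of 0] by linarith
  have lower: "A t - 2 * K / c * exp (c * t) \<le> A u" for t u
  proof (cases "u \<le> t")
    case True
    have "0 \<le> 2 * K / c * exp (c * u)" using K \<open>c > 0\<close> by simp
    then show ?thesis using anti[OF True] by linarith
  next
    case False
    have "0 \<le> 2 * K / c * exp (c * t)" using K \<open>c > 0\<close> by simp
    then show ?thesis using mono[of t u] False by linarith
  qed
  define lo where "lo = Inf (range A)"
  have "lo \<le> A t" for t
    unfolding lo_def using lower[of 0] by (intro cInf_lower) (auto intro!: bdd_belowI2)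
  moreover have "A t - 2 * K / c * exp (c * t) \<le> lo" for t
    unfolding lo_def using lower[of t] by (intro cInf_greatest) auto
  ultimately have est: "0 \<le> (A t - lo) * exp (- c * t)" "(A t - lo) * exp (- c * t) \<le> 2 * K / c" for t
  proof -
    show "0 \<le> (A t - lo) * exp (- c * t)" using \<open>\<And>t. lo \<le> A t\<close> by simp
    have "(A t - lo) * exp (- c * t) \<le> (2 * K / c * exp (c * t)) * exp (- c * t)"
      using \<open>\<And>t. A t - 2 * K / c * exp (c * t) \<le> lo\<close>[of t] by (intro mult_right_mono) auto
    also have "\<dots> = 2 * K / c" by (simp add: exp_minus field_simps)
    finally show "(A t - lo) * exp (- c * t) \<le> 2 * K / c" .
  qed
  define g where "g t = (A t - lo) * exp (- c * t) - K / c" for t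
  have "(g has_real_derivative - c * g t + G t) (at t)" for t
  proof -
    have "(g has_real_derivative exp (c * t) * (G t + K) * exp (- c * t)
        + (A t - lo) * (exp (- c * t) * (- c))) (at t)"
      unfolding g_def by (auto intro!: derivative_eq_intros A)
    moreover have "exp (c * t) * (G t + K) * exp (- c * t) = G t + K"
      by (simp add: exp_minus)
    moreover have "- c * g t = (A t - lo) * (exp (- c * t) * (- c)) + K"
      using \<open>c > 0\<close> by (simp add: g_def field_simps)
    ultimately show ?thesis by (simp add: algebra_simps)
  qed
  moreover have "\<bar>g t\<bar> \<le> K / c" for t
    using est[of t] by (auto simp: g_def abs_le_iff)
  ultimately show thesis by (rule that)
qed

section \<open>Solutions of the Riccati equation\<close>

text \<open>The bounds \<open>Q\<close> and \<open>P\<close> are parameters of the locale so that the time reversed equation is again an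
instance with the same bounds.\<close>

locale riccati =
  fixes q p :: "real \<Rightarrow> real" and Q P :: real
  assumes q_cont: "continuous_on UNIV q" and p_cont: "continuous_on UNIV p"
    and q_bound: "\<bar>q t\<bar> \<le> Q" and p_bound: "\<bar>p t\<bar> \<le> P"
begin

lemma reversed: "riccati (\<lambda>t. - q (- t)) (\<lambda>t. p (- t)) Q P"
  by unfold_locales
    (auto intro!: continuous_intros continuous_on_compose2[OF q_cont] continuous_on_compose2[OF p_cont]
      q_bound p_bound)

text \<open>The difference of two solutions solves the linear equation with coefficient \<open>q - x - y\<close>.\<close>

lemma solves_on_unique:
  assumes x: "solves_on q p lam I x" and y: "solves_on q p lam I y"
    and I: "s \<in> I" "t \<in> I" and eq: "x s = y s"
  shows "x t = y t"
proof -
  define a b where "a = min s t" and "b = max s t"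
  have sub: "u \<in> I" if "a \<le> u" "u \<le> b" for u
    using x I that unfolding solves_on_def is_interval_1 a_def b_def
    by (metis min_def max_def)
  have dx: "(x has_real_derivative - (x u)\<^sup>2 + q u * x u + p u + lam) (at u)"
    and dy: "(y has_real_derivative - (y u)\<^sup>2 + q u * y u + p u + lam) (at u)" if "u \<in> {a..b}" for u
    using x y sub that by (auto simp: solves_on_def)
  have "continuous_on {a..b} x" "continuous_on {a..b} y"
    using dx dy by (meson DERIV_isCont continuous_at_imp_continuous_on)+
  then have "continuous_on {a..b} (\<lambda>u. q u - x u - y u)"
    by (intro continuous_intros continuous_on_subset[OF q_cont]) auto
  then obtain F where F: "\<And>u. u \<in> {a..b} \<Longrightarrow>
      (F has_vector_derivative q u - x u - y u) (at u within {a..b})"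
    using antiderivative_continuous by blast
  have "\<exists>k. \<forall>u\<in>{a..b}. (x u - y u) * exp (- F u) = k"
  proof (rule has_field_derivative_zero_constant)
    fix u assume u: "u \<in> {a..b}"
    have F': "(F has_real_derivative q u - x u - y u) (at u within {a..b})"
      using F[OF u] by (simp add: has_real_derivative_iff_has_vector_derivative)
    show "((\<lambda>u. (x u - y u) * exp (- F u)) has_real_derivative 0) (at u within {a..b})"
      by (auto intro!: derivative_eq_intros F' DERIV_subset[OF dx[OF u]] DERIV_subset[OF dy[OF u]]
          simp: algebra_simps power2_eq_square)
  qed auto
  then have "(x s - y s) * exp (- F s) = (x t - y t) * exp (- F t)"
    by (auto simp: a_def b_def)
  then show ?thesis using eq by simp
qed

lemma solves_on_subset:
  assumes "solves_on q p lam I x" "J \<subseteq> I" "open J" "is_interval J"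
  shows "solves_on q p lam J x"
  using assms by (auto simp: solves_on_def)

lemma flow_eq:
  assumes x: "solves_on q p lam I x" and I: "s \<in> I" "t \<in> I"
  shows "t \<in> max_interval q p lam s (x s)" "flow q p lam t s (x s) = x t"
proof -
  show "t \<in> max_interval q p lam s (x s)"
    using assms unfolding max_interval_def by blast
  show "flow q p lam t s (x s) = x t"
    unfolding flow_def
  proof (rule the_equality)
    fix y assume "\<exists>J z. solves_on q p lam J z \<and> s \<in> J \<and> t \<in> J \<and> z s = x s \<and> z t = y"
    then obtain J z where z: "solves_on q p lam J z" "s \<in> J" "t \<in> J" "z s = x s" "z t = y"
      by blast
    have J: "open (I \<inter> J)" "is_interval (I \<inter> J)"
      using x z(1) by (auto simp: solves_on_def intro: is_interval_Int)
    have "z t = x t"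
      by (rule solves_on_unique[where I = "I \<inter> J" and s = s])
        (use x z I J in \<open>auto intro: solves_on_subset\<close>)
    then show "y = x t" using z by simp
  qed (use assms in blast)
qed

lemma max_interval_flow:
  assumes "t \<in> max_interval q p lam s x0"
  obtains I x where "solves_on q p lam I x" "s \<in> I" "t \<in> I" "x s = x0" "flow q p lam t s x0 = x t"
  using assms flow_eq unfolding max_interval_def by blast

lemma global_solution_iff:
  "global_solution q p lam x \<longleftrightarrow>
    (\<forall>t. (x has_real_derivative - (x t)\<^sup>2 + q t * x t + p t + lam) (at t))"
  by (auto simp: global_solution_def solves_on_def)

lemma global_solution_flow:
  assumes "global_solution q p lam x"
  shows "max_interval q p lam s (x s) = UNIV" "flow q p lam t s (x s) = x t"
  using flow_eq[of lam UNIV x s] assms by (auto simp: global_solution_def)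

lemma global_solution_unique:
  assumes "global_solution q p lam x" "global_solution q p lam y" "x s = y s"
  shows "x = y"
  using assms solves_on_unique[of lam UNIV x y s] by (auto simp: global_solution_def)

lemma global_solution_of_max_interval:
  assumes "max_interval q p lam s x0 = UNIV"
  shows "global_solution q p lam (\<lambda>t. flow q p lam t s x0)" "flow q p lam s s x0 = x0"
proof -
  show "flow q p lam s s x0 = x0"
    using assms max_interval_flow[of s lam s x0] by (metis UNIV_I)
  show "global_solution q p lam (\<lambda>t. flow q p lam t s x0)"
    unfolding global_solution_iff
  proof
    fix t
    obtain I x where x: "solves_on q p lam I x" "s \<in> I" "t \<in> I" "x s = x0"
      using assms max_interval_flow[of t lam s x0] by (metis UNIV_I)
    have eq: "x u = flow q p lam u s x0" if "u \<in> I" for u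
      using flow_eq(2)[OF x(1,2) that] x(4) by simp
    have "((\<lambda>u. flow q p lam u s x0) has_real_derivative - (x t)\<^sup>2 + q t * x t + p t + lam) (at t)"
      by (rule has_field_derivative_transform_within_open[where f = x and S = I])
        (use x eq in \<open>auto simp: solves_on_def\<close>)
    then show "((\<lambda>u. flow q p lam u s x0) has_real_derivative
       - (flow q p lam t s x0)\<^sup>2 + q t * flow q p lam t s x0 + p t + lam) (at t)"
      using eq[OF x(3)] by simp
  qed
qed

text \<open>Above the bound \<open>x' \<le> - x\<^sup>2 / 2\<close>. So a solution that exceeds the bound at \<open>t\<close> did so before, and then
\<open>1 / x\<close>, which lies between \<open>0\<close> and \<open>1\<close>, would have grown by at least \<open>1\<close> in time \<open>2\<close>.\<close>

lemma solution_upper_bound: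
  assumes deriv: "\<And>u. u \<in> {t - 2..t} \<Longrightarrow>
      (x has_real_derivative - (x u)\<^sup>2 + q u * x u + p u + lam) (at u)"
  shows "x t \<le> 2 * (Q + P + \<bar>lam\<bar>) + 1"
proof (rule ccontr)
  define M where "M = 2 * (Q + P + \<bar>lam\<bar>) + 1"
  assume "\<not> x t \<le> 2 * (Q + P + \<bar>lam\<bar>) + 1"
  then have big: "M < x t" by (simp add: M_def)
  have "Q \<ge> 0" "P \<ge> 0" using q_bound[of 0] p_bound[of 0] by linarith+
  then have M1: "M \<ge> 1" by (simp add: M_def)
  have rhs: "- y\<^sup>2 + q u * y + p u + lam \<le> - (1 / 2) * y\<^sup>2" if "M < y" for y u
  proof -
    have y: "y \<ge> 1" "2 * (Q + P + \<bar>lam\<bar>) \<le> y" using that M1 by (auto simp: M_def)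
    have "q u * y \<le> Q * y" using q_bound[of u] y by (intro mult_right_mono) auto
    moreover have "p u + lam \<le> (P + \<bar>lam\<bar>) * 1" using p_bound[of u] by simp
    moreover have "(P + \<bar>lam\<bar>) * 1 \<le> (P + \<bar>lam\<bar>) * y"
      using y \<open>P \<ge> 0\<close> by (intro mult_left_mono) auto
    moreover have "2 * (Q + P + \<bar>lam\<bar>) * y \<le> y * y"
      using y by (intro mult_right_mono) auto
    ultimately show ?thesis by (simp add: power2_eq_square algebra_simps)
  qed
  have above: "M < x u" if u: "u \<in> {t - 2..t}" for u
  proof (rule ccontr)
    assume "\<not> M < x u"
    then have "x t - M \<le> 0"
      using u rhs
      by (intro stays_nonpositive[of u t "\<lambda>t. x t - M" "\<lambda>t. - (x t)\<^sup>2 + q t * x t + p t + lam"])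
        (auto intro!: derivative_eq_intros deriv order_trans[OF rhs, simplified])
    then show False using big by simp
  qed
  have "1 / x (t - 2) - (t - 2) / 2 \<le> 1 / x t - t / 2"
  proof (rule DERIV_nonneg_imp_nondecreasing[where f = "\<lambda>u. 1 / x u - u / 2"])
    fix z assume z: "t - 2 \<le> z" "z \<le> t"
    then have xz: "M < x z" "x z > 0" using above[of z] M1 by auto
    have "((\<lambda>u. 1 / x u - u / 2) has_real_derivative
        - (- (x z)\<^sup>2 + q z * x z + p z + lam) / (x z)\<^sup>2 - 1 / 2) (at z)"
      using z xz by (auto intro!: derivative_eq_intros deriv simp: power2_eq_square)
    moreover have "0 \<le> - (- (x z)\<^sup>2 + q z * x z + p z + lam) / (x z)\<^sup>2 - 1 / 2"
      using rhs[OF xz(1), of z] xz(2) by (simp add: field_simps)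
    ultimately show "\<exists>y. ((\<lambda>u. 1 / x u - u / 2) has_real_derivative y) (at z) \<and> 0 \<le> y" by blast
  qed simp
  moreover have "1 / x (t - 2) > 0" using above[of "t - 2"] M1 by simp
  moreover have "1 / x t < 1" using big M1 by simp
  ultimately show False by (simp add: field_simps)
qed

lemma global_solution_reversed:
  assumes "global_solution q p lam x"
  shows "global_solution (\<lambda>t. - q (- t)) (\<lambda>t. p (- t)) lam (\<lambda>t. - x (- t))"
proof -
  interpret R: riccati "\<lambda>t. - q (- t)" "\<lambda>t. p (- t)" Q P by (rule reversed)
  have d: "(x has_real_derivative - (x t)\<^sup>2 + q t * x t + p t + lam) (at t)" for t
    using assms by (simp add: global_solution_iff)
  show ?thesis
    unfolding R.global_solution_iff
    by (auto intro!: derivative_eq_intros DERIV_chain2[OF d])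
qed

text \<open>In particular every global solution is bounded, and global existence alone characterises bounded orbits.\<close>

lemma global_solution_bound:
  assumes "global_solution q p lam x"
  shows "\<bar>x t\<bar> \<le> 2 * (Q + P + \<bar>lam\<bar>) + 1"
proof -
  interpret R: riccati "\<lambda>t. - q (- t)" "\<lambda>t. p (- t)" Q P by (rule reversed)
  have "x t \<le> 2 * (Q + P + \<bar>lam\<bar>) + 1"
    using assms by (intro solution_upper_bound) (auto simp: global_solution_iff)
  moreover have "- x (- (- t)) \<le> 2 * (Q + P + \<bar>lam\<bar>) + 1"
    using global_solution_reversed[OF assms]
    by (intro R.solution_upper_bound[of "- t" "\<lambda>t. - x (- t)" lam]) (auto simp: R.global_solution_iff)
  ultimately show ?thesis by auto
qed

lemma bounded_orbits_iff:
  "(s, x0) \<in> bounded_orbits q p lam \<longleftrightarrow> (\<exists>x. global_solution q p lam x \<and> x s = x0)"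
proof
  assume "(s, x0) \<in> bounded_orbits q p lam"
  then have "max_interval q p lam s x0 = UNIV" by (simp add: bounded_orbits_def)
  from global_solution_of_max_interval[OF this]
  show "\<exists>x. global_solution q p lam x \<and> x s = x0" by blast
next
  assume "\<exists>x. global_solution q p lam x \<and> x s = x0"
  then obtain x where x: "global_solution q p lam x" "x s = x0" by blast
  have "bounded (range x)"
    using global_solution_bound[OF x(1)] by (auto intro!: boundedI)
  moreover have "flow q p lam t s x0 = x t" for t
    using global_solution_flow(2)[OF x(1), of t s] x(2) by auto
  ultimately show "(s, x0) \<in> bounded_orbits q p lam"
    using global_solution_flow(1)[OF x(1), of s] x(2) by (simp add: bounded_orbits_def)
qed

lemma bounded_orbits_empty_iff:
  "bounded_orbits q p lam = {} \<longleftrightarrow> (\<nexists>x. global_solution q p lam x)"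
  using bounded_orbits_iff[of _ _ lam] by fast

section \<open>Existence\<close>

text \<open>Dominated convergence in the integrated equation. The term \<open>c (f n - g n)\<close>, which disappears in the limit,
allows for the iteration below, where \<open>g n\<close> is the successor of \<open>f n\<close>; with \<open>c = 0\<close> and \<open>f = g\<close> this is the
limit of solutions for varying parameters.\<close>

lemma limit_of_approximate_solutions:
  fixes f g :: "nat \<Rightarrow> real \<Rightarrow> real"
  assumes deriv: "\<And>n t. (g n has_real_derivative
      c * (f n t - g n t) - (f n t)\<^sup>2 + q t * f n t + p t + l n) (at t)"
    and cont: "\<And>n. continuous_on UNIV (f n)"
    and bound: "\<And>n t. \<bar>f n t\<bar> \<le> M" "\<And>n t. \<bar>g n t\<bar> \<le> M" "\<And>n. \<bar>l n\<bar> \<le> R"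
    and lim: "\<And>t. (\<lambda>n. f n t) \<longlonglongrightarrow> x t" "\<And>t. (\<lambda>n. g n t) \<longlonglongrightarrow> x t" "l \<longlonglongrightarrow> lam"
  shows "global_solution q p lam x"
proof -
  define H where "H n t = c * (f n t - g n t) - (f n t)\<^sup>2 + q t * f n t + p t + l n" for n t
  define X where "X t = - (x t)\<^sup>2 + q t * x t + p t + lam" for t
  define C where "C = \<bar>c\<bar> * (2 * M) + M\<^sup>2 + Q * M + P + R"
  have cont_g: "continuous_on UNIV (g n)" for n
    using deriv by (rule continuous_on_of_derivative)
  have H_cont: "continuous_on {u..v} (H n)" for u v n
    unfolding H_def
    by (intro continuous_intros continuous_on_subset[OF cont_g] continuous_on_subset[OF cont]
        continuous_on_subset[OF q_cont] continuous_on_subset[OF p_cont]) auto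
  have H_bound: "norm (H n t) \<le> C" for n t
  proof -
    have "\<bar>c * (f n t - g n t)\<bar> \<le> \<bar>c\<bar> * (2 * M)"
      using bound(1)[of n t] bound(2)[of n t] unfolding abs_mult by (intro mult_left_mono) linarith+
    moreover have "\<bar>q t * f n t\<bar> \<le> Q * M"
      using q_bound[of t] bound(1)[of n t] unfolding abs_mult by (intro mult_mono) linarith+
    moreover have "(f n t)\<^sup>2 \<le> M\<^sup>2"
      using bound(1)[of n t] by (metis abs_ge_zero power2_abs power_mono)
    moreover have "0 \<le> (f n t)\<^sup>2" by simp
    ultimately show ?thesis
      using p_bound[of t] bound(3)[of n] unfolding H_def C_def real_norm_def by linarith
  qed
  have H_lim: "(\<lambda>n. H n t) \<longlonglongrightarrow> X t" for t
  proof -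
    have "(\<lambda>n. H n t) \<longlonglongrightarrow> c * (x t - x t) - (x t)\<^sup>2 + q t * x t + p t + lam"
      unfolding H_def by (intro tendsto_intros lim)
    then show ?thesis by (simp add: X_def)
  qed
  have H_int: "(H n has_integral g n v - g n u) {u..v}" if "u \<le> v" for u v n
    using that deriv unfolding H_def
    by (intro fundamental_theorem_of_calculus)
      (auto simp: has_real_derivative_iff_has_vector_derivative[symmetric] intro: DERIV_subset)
  have X_int: "X integrable_on {u..v}" "integral {u..v} X = x v - x u" if "u \<le> v" for u v
  proof -
    note dct = dominated_convergence[of H "{u..v}" "\<lambda>_. C" X, OF _ _ H_bound H_lim]
    have int: "H n integrable_on {u..v}" for n using H_int[OF that] by blast
    show "X integrable_on {u..v}" by (rule dct(1)[OF int]) auto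
    have "(\<lambda>n. integral {u..v} (H n)) \<longlonglongrightarrow> integral {u..v} X"
      by (rule dct(2)[OF int]) auto
    moreover have "integral {u..v} (H n) = g n v - g n u" for n
      using H_int[OF that] by blast
    moreover have "(\<lambda>n. g n v - g n u) \<longlonglongrightarrow> x v - x u" by (intro tendsto_intros lim)
    ultimately show "integral {u..v} X = x v - x u" using LIMSEQ_unique by auto
  qed
  show ?thesis
    unfolding global_solution_iff
  proof
    fix t :: real
    define u v where "u = t - 1" and "v = t + 1"
    have eq: "x u + integral {u..z} X = x z" if "z \<in> {u..v}" for z
      using X_int(2)[of u z] that by simp
    have "continuous_on {u..v} (\<lambda>z. x u + integral {u..z} X)"
      by (intro continuous_intros indefinite_integral_continuous_1 X_int) (simp add: u_def v_def)
    then have "continuous_on {u..v} x"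
      by (rule continuous_on_eq) (rule eq)
    then have "continuous_on {u..v} X"
      unfolding X_def
      by (intro continuous_intros continuous_on_subset[OF q_cont] continuous_on_subset[OF p_cont]) auto
    then have "((\<lambda>z. x u + integral {u..z} X) has_real_derivative 0 + X t) (at t within {u..v})"
      by (intro DERIV_add DERIV_const integral_has_real_derivative) (auto simp: u_def v_def)
    then have "((\<lambda>z. x u + integral {u..z} X) has_real_derivative X t) (at t)"
      by (simp add: at_within_Icc_at u_def v_def)
    then have "(x has_real_derivative X t) (at t)"
      by (rule has_field_derivative_transform_within_open[where S = "{u<..<v}"])
        (auto simp: eq, auto simp: u_def v_def)
    then show "(x has_real_derivative - (x t)\<^sup>2 + q t * x t + p t + lam) (at t)"
      by (simp add: X_def)
  qed
qed

text \<open>Monotone iteration \<open>F (n + 1)' = - c F (n + 1) + G (F n)\<close>, started at a constant \<open>M\<close>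
that bounds \<open>w\<close> and all global solutions. Both kinds of functions are lower solutions for the iteration, so they
stay below all iterates and below the limit.\<close>

lemma maximal_solution_above_lower_solution:
  assumes w_deriv: "\<And>t. (w has_real_derivative w' t) (at t)"
    and w_lower: "\<And>t. w' t \<le> - (w t)\<^sup>2 + q t * w t + p t + lam"
    and w_bound: "\<And>t. \<bar>w t\<bar> \<le> N"
  obtains a where "global_solution q p lam a" "\<And>t. w t \<le> a t"
    "\<And>b t. global_solution q p lam b \<Longrightarrow> b t \<le> a t"
proof -
  define M where "M = N + 2 * (Q + P + \<bar>lam\<bar>) + 1"
  \<comment> \<open>makes \<open>G\<close> increasing in its first argument on \<open>{- M..M}\<close>\<close>
  define c where "c = 2 * M + Q + 1"
  define G where "G f t = c * f - f\<^sup>2 + q t * f + p t + lam" for f t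
  define lower where "lower v \<longleftrightarrow> (\<forall>t. \<bar>v t\<bar> \<le> M) \<and>
    (\<exists>v'. \<forall>t. (v has_real_derivative v' t) (at t) \<and> v' t \<le> - c * v t + G (v t) t)" for v
  have "Q \<ge> 0" "P \<ge> 0" "N \<ge> 0"
    using q_bound[of 0] p_bound[of 0] w_bound[of 0] by linarith+
  then have M: "M \<ge> 1" "c > 0" by (auto simp: M_def c_def)
  have wM: "\<bar>w t\<bar> \<le> M" for t
    using w_bound[of t] \<open>Q \<ge> 0\<close> \<open>P \<ge> 0\<close> by (simp add: M_def)
  have lower_w: "lower w"
  proof -
    show ?thesis
      using wM w_deriv w_lower unfolding lower_def G_def by (intro conjI exI[of _ w']) (auto simp: algebra_simps)
  qed
  have lower_global: "lower b" if "global_solution q p lam b" for b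
  proof -
    have "\<bar>b t\<bar> \<le> M" for t
      using global_solution_bound[OF that, of t] \<open>N \<ge> 0\<close> by (simp add: M_def)
    then show ?thesis
      using that unfolding lower_def G_def global_solution_iff
      by (intro conjI exI[of _ "\<lambda>t. - (b t)\<^sup>2 + q t * b t + p t + lam"]) auto
  qed
  have G_mono: "G u t \<le> G v t" if "- M \<le> u" "u \<le> v" "v \<le> M" for u v t
  proof -
    have "(v - u) * (c + q t - (u + v)) \<ge> 0"
      using that q_bound[of t] by (intro mult_nonneg_nonneg) (auto simp: c_def)
    then show ?thesis by (simp add: G_def power2_eq_square algebra_simps)
  qed
  have G_upper: "G M t \<le> c * M" for t
  proof -
    have "q t * M \<le> Q * M" using q_bound[of t] M by (intro mult_right_mono) auto
    moreover have "p t + lam \<le> (P + \<bar>lam\<bar>) * 1" using p_bound[of t] by simp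
    moreover have "(P + \<bar>lam\<bar>) * 1 \<le> (P + \<bar>lam\<bar>) * M"
      using M \<open>P \<ge> 0\<close> by (intro mult_left_mono) auto
    moreover have "(Q + P + \<bar>lam\<bar>) * M \<le> M * M"
      using M \<open>Q \<ge> 0\<close> \<open>P \<ge> 0\<close> \<open>N \<ge> 0\<close> by (intro mult_right_mono) (auto simp: M_def)
    ultimately show ?thesis by (simp add: G_def power2_eq_square algebra_simps)
  qed
  define adm where "adm f \<longleftrightarrow> continuous_on UNIV f \<and> (\<forall>t. \<bar>f t\<bar> \<le> M) \<and>
    (\<forall>v. lower v \<longrightarrow> (\<forall>t. v t \<le> f t))" for f
  define step where "step f g \<longleftrightarrow> (\<forall>t. (g has_real_derivative - c * g t + G (f t) t) (at t))" for f g
  have step_exists: "\<exists>g. adm g \<and> step f g" if f: "adm f" for f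
  proof -
    define K where "K = \<bar>c\<bar> * M + M\<^sup>2 + Q * M + P + \<bar>lam\<bar>"
    have G_cont: "continuous_on UNIV (\<lambda>t. G (f t) t)"
      unfolding G_def using f
      by (intro continuous_intros q_cont p_cont) (auto simp: adm_def)
    have G_bound: "\<bar>G (f t) t\<bar> \<le> K" for t
    proof -
      have fM: "\<bar>f t\<bar> \<le> M" using f by (simp add: adm_def)
      then have "\<bar>c * f t\<bar> \<le> \<bar>c\<bar> * M" unfolding abs_mult by (intro mult_left_mono) auto
      moreover have "\<bar>q t * f t\<bar> \<le> Q * M"
        using q_bound[of t] fM unfolding abs_mult by (intro mult_mono) linarith+
      moreover have "(f t)\<^sup>2 \<le> M\<^sup>2"
        using fM by (metis abs_ge_zero power2_abs power_mono)
      moreover have "0 \<le> (f t)\<^sup>2" by simp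
      ultimately show ?thesis
        using p_bound[of t] unfolding G_def K_def by linarith
    qed
    obtain g where g: "\<And>t. (g has_real_derivative - c * g t + G (f t) t) (at t)"
      and gK: "\<And>t. \<bar>g t\<bar> \<le> K / c"
      by (rule linear_bounded_solution[OF G_cont G_bound \<open>c > 0\<close>]) blast
    have above: "v t \<le> g t" if v: "lower v" for v t
    proof -
      obtain v' where v': "\<And>t. (v has_real_derivative v' t) (at t)"
        "\<And>t. v' t \<le> - c * v t + G (v t) t"
        using v by (auto simp: lower_def)
      have "0 / c \<le> g t - v t"
      proof (rule linear_differential_lower_bound[OF DERIV_diff[OF g v'(1)] _ _ \<open>c > 0\<close>])
        fix u
        have "\<bar>v u\<bar> \<le> M" "\<bar>f u\<bar> \<le> M" "v u \<le> f u" using v f by (auto simp: lower_def adm_def)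
        then have "G (v u) u \<le> G (f u) u" by (intro G_mono) auto
        then show "- c * (g u - v u) + 0 \<le> - c * g u + G (f u) u - v' u"
          using v'(2)[of u] by (simp add: algebra_simps)
        show "- (K / c) - M \<le> g u - v u" using gK[of u] \<open>\<bar>v u\<bar> \<le> M\<close> by linarith
      qed
      then show ?thesis by simp
    qed
    have below: "g t \<le> M" for t
    proof -
      have "0 / c \<le> M - g t"
      proof (rule linear_differential_lower_bound[OF DERIV_diff[OF DERIV_const g] _ _ \<open>c > 0\<close>])
        fix u
        have "\<bar>f u\<bar> \<le> M" using f by (auto simp: adm_def)
        then have "G (f u) u \<le> G M u" by (intro G_mono) auto
        then show "- c * (M - g u) + 0 \<le> 0 - (- c * g u + G (f u) u)"
          using G_upper[of u] by (simp add: algebra_simps)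
        show "M - K / c \<le> M - g u" using gK[of u] by linarith
      qed
      then show ?thesis by simp
    qed
    have "\<bar>g t\<bar> \<le> M" for t
      using below[of t] above[OF lower_w, of t] wM[of t] by linarith
    moreover have "continuous_on UNIV g"
      using g by (rule continuous_on_of_derivative)
    ultimately show ?thesis
      using above g by (auto simp: adm_def step_def)
  qed
  have "adm (\<lambda>_. M)"
    using M by (auto simp: adm_def lower_def abs_le_iff)
  then have "\<exists>F. \<forall>n. (adm (F n) \<and> (n = 0 \<longrightarrow> F n = (\<lambda>_. M))) \<and> step (F n) (F (Suc n))"
    by (intro dependent_nat_choice[where P = "\<lambda>n f. adm f \<and> (n = 0 \<longrightarrow> f = (\<lambda>_. M))"])
      (use step_exists in auto)
  then obtain F where F0: "F 0 = (\<lambda>_. M)" and adm: "\<And>n. adm (F n)"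
    and step: "\<And>n t. (F (Suc n) has_real_derivative - c * F (Suc n) t + G (F n t) t) (at t)"
    unfolding step_def by blast
  have FM: "\<bar>F n t\<bar> \<le> M" for n t using adm by (simp add: adm_def)
  have dec: "F (Suc n) t \<le> F n t" for n t
  proof (induction n arbitrary: t)
    case 0
    then show ?case using FM[of 1 t] by (simp add: F0)
  next
    case (Suc n)
    have "0 / c \<le> F (Suc n) t - F (Suc (Suc n)) t"
    proof (rule linear_differential_lower_bound[OF DERIV_diff[OF step step] _ _ \<open>c > 0\<close>])
      fix u
      have "G (F (Suc n) u) u \<le> G (F n u) u"
        using FM[of n u] FM[of "Suc n" u] Suc.IH[of u] by (intro G_mono) auto
      then show "- c * (F (Suc n) u - F (Suc (Suc n)) u) + 0 \<le>
          - c * F (Suc n) u + G (F n u) u - (- c * F (Suc (Suc n)) u + G (F (Suc n) u) u)"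
        by (simp add: algebra_simps)
      show "- M - M \<le> F (Suc n) u - F (Suc (Suc n)) u"
        using FM[of "Suc n" u] FM[of "Suc (Suc n)" u] by linarith
    qed
    then show ?case by simp
  qed
  have "convergent (\<lambda>n. F n t)" for t
  proof (rule Bseq_monoseq_convergent)
    show "Bseq (\<lambda>n. F n t)" using FM by (intro BseqI'[of _ M]) simp
    show "monoseq (\<lambda>n. F n t)" using dec by (simp add: monoseq_Suc)
  qed
  then obtain a where lim: "\<And>t. (\<lambda>n. F n t) \<longlonglongrightarrow> a t"
    unfolding convergent_def by metis
  have "global_solution q p lam a"
  proof (rule limit_of_approximate_solutions[where f = F and g = "\<lambda>n. F (Suc n)" and c = c
        and l = "\<lambda>_. lam" and M = M])
    show "(F (Suc n) has_real_derivative
        c * (F n t - F (Suc n) t) - (F n t)\<^sup>2 + q t * F n t + p t + lam) (at t)" for n t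
      using step[of n t] by (simp add: G_def algebra_simps)
    show "continuous_on UNIV (F n)" for n using adm by (simp add: adm_def)
    show "(\<lambda>n. F (Suc n) t) \<longlonglongrightarrow> a t" for t using lim by (rule LIMSEQ_Suc)
  qed (use FM lim in auto)
  moreover have "v t \<le> a t" if "lower v" for v t
    using adm that by (intro LIMSEQ_le_const[OF lim]) (auto simp: adm_def)
  ultimately show thesis
    using that lower_w lower_global by blast
qed

end

section \<open>All solutions from a known one\<close>

text \<open>\<open>exp H\<close> solves the linearisation of the equation along the solution \<open>b\<close>, and \<open>W\<close> is an antiderivative of
\<open>exp H\<close>. Both are determined up to the choice of additive constants, which cancel in all uses.\<close>

definition variation :: "(real \<Rightarrow> real) \<Rightarrow> (real \<Rightarrow> real) \<Rightarrow> (real \<Rightarrow> real) \<Rightarrow> (real \<Rightarrow> real) \<Rightarrow> bool" where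
  "variation q b H W \<longleftrightarrow> (\<forall>t. (H has_real_derivative - 2 * b t + q t) (at t)) \<and>
     (\<forall>t. (W has_real_derivative exp (H t)) (at t))"

lemma variation_strict_mono:
  assumes "variation q b H W" "u < v"
  shows "W u < W v"
  using assms(2)
  by (rule DERIV_pos_imp_increasing) (use assms(1) exp_gt_zero in \<open>unfold variation_def, blast\<close>)

lemma variation_mono:
  assumes "variation q b H W" "u \<le> v"
  shows "W u \<le> W v"
  using variation_strict_mono[OF assms(1), of u v] assms(2) by (cases "u = v") auto

lemma affine_positive_between:
  fixes A B C k :: real
  assumes "A \<le> B" "B \<le> C" "1 + k * A > 0" "1 + k * C > 0"
  shows "1 + k * B > 0"
proof (cases "k \<ge> 0")
  case True
  then have "k * A \<le> k * B" using assms by (intro mult_left_mono)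
  then show ?thesis using assms by linarith
next
  case False
  then have "k * C \<le> k * B" using assms by (intro mult_left_mono_neg) auto
  then show ?thesis using assms by linarith
qed

context riccati begin

lemma global_solution_continuous:
  assumes "global_solution q p lam b"
  shows "continuous_on A b"
  using assms by (intro continuous_on_of_derivative) (auto simp: global_solution_iff)

lemma variation_exists:
  assumes "global_solution q p lam b"
  obtains H W where "variation q b H W"
proof -
  have "continuous_on UNIV (\<lambda>t. - 2 * b t + q t)"
    by (intro continuous_intros q_cont global_solution_continuous[OF assms])
  then obtain H where H: "\<And>t. (H has_real_derivative - 2 * b t + q t) (at t)"
    by (rule antiderivative_exists) blast
  have "continuous_on UNIV (\<lambda>t. exp (H t))"
    by (intro continuous_intros continuous_on_of_derivative[OF H])
  then obtain W where "\<And>t. (W has_real_derivative exp (H t)) (at t)"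
    by (rule antiderivative_exists) blast
  with H show thesis by (intro that[of H W]) (simp add: variation_def)
qed

text \<open>The classical reduction: with \<open>x = b + y\<close> the equation becomes the Bernoulli equation \<open>y' = (q - 2 b) y - y\<^sup>2\<close>,
which is linear in \<open>1 / y\<close>.\<close>

lemma solves_on_from_known_solution:
  assumes b: "global_solution q p lam b" and HW: "variation q b H W"
  shows "solves_on q p lam {t. 1 + k * (W t - W s) > 0}
    (\<lambda>t. b t + k * exp (H t) / (1 + k * (W t - W s)))"
  unfolding solves_on_def
proof (intro conjI ballI)
  have W_cont: "continuous_on UNIV W"
    using HW by (intro continuous_on_of_derivative) (auto simp: variation_def)
  show "open {t. 1 + k * (W t - W s) > 0}"
    by (intro open_Collect_less continuous_intros W_cont)
  show "is_interval {t. 1 + k * (W t - W s) > 0}"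
    unfolding is_interval_1
  proof clarify
    fix u v t assume "1 + k * (W u - W s) > 0" "1 + k * (W v - W s) > 0" "u \<le> t" "t \<le> v"
    then show "1 + k * (W t - W s) > 0"
      using variation_mono[OF HW, of u t] variation_mono[OF HW, of t v]
      by (intro affine_positive_between[of "W u - W s" "W t - W s" "W v - W s"]) auto
  qed
next
  fix t assume t: "t \<in> {t. 1 + k * (W t - W s) > 0}"
  define D where "D = 1 + k * (W t - W s)"
  have D: "D \<noteq> 0" using t by (simp add: D_def)
  have dH: "(H has_real_derivative - 2 * b t + q t) (at t)"
    and dW: "(W has_real_derivative exp (H t)) (at t)"
    and db: "(b has_real_derivative - (b t)\<^sup>2 + q t * b t + p t + lam) (at t)"
    using HW b by (auto simp: variation_def global_solution_iff)
  define e where "e = k * exp (H t) / D"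
  have deriv: "((\<lambda>t. b t + k * exp (H t) / (1 + k * (W t - W s))) has_real_derivative
      - (b t)\<^sup>2 + q t * b t + p t + lam
      + (k * (exp (H t) * (- 2 * b t + q t)) * D - k * exp (H t) * (k * exp (H t))) / (D * D)) (at t)"
    using D unfolding D_def by (auto intro!: derivative_eq_intros dH dW db)
  have quotient: "(k * (exp (H t) * (- 2 * b t + q t)) * D - k * exp (H t) * (k * exp (H t))) / (D * D)
      = (- 2 * b t + q t) * e - e\<^sup>2"
    using D by (simp add: e_def power2_eq_square diff_divide_distrib)
  have square: "- (b t)\<^sup>2 + q t * b t + p t + lam + ((- 2 * b t + q t) * e - e\<^sup>2)
      = - (b t + e)\<^sup>2 + q t * (b t + e) + p t + lam"
    by (simp add: power2_eq_square algebra_simps)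
  show "((\<lambda>t. b t + k * exp (H t) / (1 + k * (W t - W s))) has_real_derivative
      - (b t + k * exp (H t) / (1 + k * (W t - W s)))\<^sup>2
      + q t * (b t + k * exp (H t) / (1 + k * (W t - W s))) + p t + lam) (at t)"
    using deriv unfolding quotient square by (simp only: e_def D_def)
qed

lemma flow_from_known_solution:
  assumes b: "global_solution q p lam b" and HW: "variation q b H W"
    and pos: "1 + (x0 - b s) * exp (- H s) * (W t - W s) > 0"
  shows "t \<in> max_interval q p lam s x0"
    and "flow q p lam t s x0 =
      b t + (x0 - b s) * exp (H t - H s) / (1 + (x0 - b s) * exp (- H s) * (W t - W s))"
proof -
  define k where "k = (x0 - b s) * exp (- H s)"
  let ?x = "\<lambda>t. b t + k * exp (H t) / (1 + k * (W t - W s))"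
  have "?x s = x0" by (simp add: k_def exp_minus field_simps)
  then have "t \<in> max_interval q p lam s x0" "flow q p lam t s x0 = ?x t"
    using flow_eq[OF solves_on_from_known_solution[OF b HW, of k s], of s t] pos
    by (simp_all add: k_def)
  then show "t \<in> max_interval q p lam s x0"
    and "flow q p lam t s x0 =
      b t + (x0 - b s) * exp (H t - H s) / (1 + (x0 - b s) * exp (- H s) * (W t - W s))"
    by (simp_all add: k_def exp_diff exp_minus divide_inverse mult.assoc mult.left_commute)
qed

text \<open>If \<open>x0 > a s\<close>, the solution through \<open>(s, x0)\<close> cannot be global by maximality of \<open>a\<close>, so the denominator in
the explicit formula vanishes somewhere. By monotonicity this happens to the left of \<open>s\<close>, and there the solution
tends to \<open>\<infinity>\<close>.\<close>

lemma le_maximal_solution_of_bdd_above: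
  assumes a: "global_solution q p lam a" and max: "\<And>b. global_solution q p lam b \<Longrightarrow> b s \<le> a s"
    and bdd: "bdd_above ((\<lambda>t. flow q p lam t s x0) ` (max_interval q p lam s x0 \<inter> {..s}))"
  shows "x0 \<le> a s"
proof (rule ccontr)
  assume "\<not> x0 \<le> a s"
  then have x0: "x0 > a s" by simp
  obtain H W where HW: "variation q a H W" using variation_exists[OF a] .
  define k where "k = (x0 - a s) * exp (- H s)"
  define D where "D t = 1 + k * (W t - W s)" for t
  have k: "k > 0" using x0 by (simp add: k_def)
  have D_strict: "D u < D v" if "u < v" for u v
    using variation_strict_mono[OF HW that] k by (simp add: D_def)
  have W_cont: "continuous_on A W" for A
    using HW by (intro continuous_on_of_derivative) (auto simp: variation_def)
  have H_cont: "continuous_on A H" for A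
    using HW by (intro continuous_on_of_derivative) (auto simp: variation_def)
  have D_cont: "continuous_on A D" for A
    unfolding D_def by (intro continuous_intros W_cont)
  show False
  proof (cases "\<forall>t. D t > 0")
    case True
    then have "global_solution q p lam (\<lambda>t. a t + k * exp (H t) / D t)"
      using solves_on_from_known_solution[OF a HW, of k s] by (simp add: global_solution_def D_def)
    from max[OF this] have "k * exp (H s) \<le> 0" by (simp add: D_def)
    then show False using k by (simp add: mult_le_0_iff)
  next
    case False
    then obtain t1 where t1: "D t1 \<le> 0" by (auto simp: not_less)
    have Ds: "D s = 1" by (simp add: D_def)
    have "t1 < s" using t1 Ds D_strict[of s t1] by (cases s t1 rule: linorder_cases) auto
    then obtain t2 where t2: "t2 \<le> s" "D t2 = 0"
      using IVT'[of D t1 0 s] t1 Ds D_cont by auto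
    then have "t2 < s" using Ds by (cases "t2 = s") auto
    obtain K where K: "\<And>t. t \<in> max_interval q p lam s x0 \<Longrightarrow> t \<le> s \<Longrightarrow> flow q p lam t s x0 \<le> K"
      using bdd by (auto simp: bdd_above_def)
    have "0 \<le> (K - a u) * D u - k * exp (H u)" if u: "t2 < u" "u \<le> s" for u
    proof -
      have Du: "D u > 0" using D_strict[OF u(1)] t2 by simp
      have "a u + k * exp (H u) / D u \<le> K"
        using flow_from_known_solution[OF a HW, of x0 s u] K[of u] Du u(2)
        by (simp add: D_def k_def exp_diff exp_minus divide_inverse mult.assoc mult.left_commute)
      then show ?thesis using Du by (simp add: field_simps)
    qed
    then have "eventually (\<lambda>u. 0 \<le> (K - a u) * D u - k * exp (H u)) (at_right t2)"
      by (intro eventually_mono[OF eventually_at_right_real[OF \<open>t2 < s\<close>]]) auto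
    moreover have "((\<lambda>u. (K - a u) * D u - k * exp (H u)) \<longlongrightarrow> (K - a t2) * D t2 - k * exp (H t2)) (at_right t2)"
    proof -
      have "continuous_on UNIV (\<lambda>u. (K - a u) * D u - k * exp (H u))"
        by (intro continuous_intros D_cont H_cont global_solution_continuous[OF a])
      then have "isCont (\<lambda>u. (K - a u) * D u - k * exp (H u)) t2"
        by (simp add: continuous_on_eq_continuous_at)
      then show ?thesis
        unfolding isCont_def by (rule tendsto_within_subset) simp
    qed
    ultimately have "0 \<le> (K - a t2) * D t2 - k * exp (H t2)"
      by (intro tendsto_lowerbound) auto
    then have "k * exp (H t2) \<le> 0" using t2 by simp
    then show False using k by (simp add: mult_le_0_iff)
  qed
qed

lemma upper_sol_eq_maximal:
  assumes a: "global_solution q p lam a" and max: "\<And>b t. global_solution q p lam b \<Longrightarrow> b t \<le> a t"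
  shows "upper_sol q p lam = a"
proof
  fix s
  show "upper_sol q p lam s = a s"
    unfolding upper_sol_def
  proof (rule Greatest_equality)
    have "a t \<le> 2 * (Q + P + \<bar>lam\<bar>) + 1" for t
      using global_solution_bound[OF a, of t] by simp
    then show "bdd_above ((\<lambda>t. flow q p lam t s (a s)) ` (max_interval q p lam s (a s) \<inter> {..s}))"
      using global_solution_flow[OF a] by (auto intro!: bdd_aboveI2)
    show "x0 \<le> a s"
      if "bdd_above ((\<lambda>t. flow q p lam t s x0) ` (max_interval q p lam s x0 \<inter> {..s}))" for x0
      using le_maximal_solution_of_bdd_above[of lam a s x0] a max that by simp
  qed
qed

lemma upper_sol_maximal:
  assumes "global_solution q p lam x"
  shows "global_solution q p lam (upper_sol q p lam)"
    and "global_solution q p lam b \<Longrightarrow> b t \<le> upper_sol q p lam t"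
    and "bdd_above ((\<lambda>t. flow q p lam t s x0) ` (max_interval q p lam s x0 \<inter> {..s})) \<Longrightarrow>
      x0 \<le> upper_sol q p lam s"
proof -
  obtain a where a: "global_solution q p lam a" "\<And>b t. global_solution q p lam b \<Longrightarrow> b t \<le> a t"
  proof (rule maximal_solution_above_lower_solution[of x _ lam "2 * (Q + P + \<bar>lam\<bar>) + 1"])
    show "(x has_real_derivative - (x t)\<^sup>2 + q t * x t + p t + lam) (at t)" for t
      using assms by (simp add: global_solution_iff)
  qed (use global_solution_bound[OF assms] in auto)
  then have eq: "upper_sol q p lam = a" by (rule upper_sol_eq_maximal)
  show "global_solution q p lam (upper_sol q p lam)" using a eq by simp
  show "b t \<le> upper_sol q p lam t" if "global_solution q p lam b" using a that eq by simp
  show "x0 \<le> upper_sol q p lam s"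
    if "bdd_above ((\<lambda>t. flow q p lam t s x0) ` (max_interval q p lam s x0 \<inter> {..s}))"
    using le_maximal_solution_of_bdd_above[of lam a s x0] a that eq by simp
qed

lemma solves_on_reversed:
  assumes "solves_on q p lam I x"
  shows "solves_on (\<lambda>t. - q (- t)) (\<lambda>t. p (- t)) lam (uminus ` I) (\<lambda>t. - x (- t))"
  unfolding solves_on_def
proof (intro conjI ballI)
  show "open (uminus ` I)" "is_interval (uminus ` I)"
    using assms by (auto simp: solves_on_def open_negations)
  fix t assume "t \<in> uminus ` I"
  then have d: "(x has_real_derivative - (x (- t))\<^sup>2 + q (- t) * x (- t) + p (- t) + lam) (at (- t))"
    using assms by (auto simp: solves_on_def)
  have "((\<lambda>t. x (- t)) has_real_derivative
      (- (x (- t))\<^sup>2 + q (- t) * x (- t) + p (- t) + lam) * (- 1)) (at t)"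
    by (rule DERIV_chain2[where f = x and g = uminus, OF d]) (auto intro!: derivative_eq_intros)
  from DERIV_minus[OF this]
  show "((\<lambda>t. - x (- t)) has_real_derivative
      - (- x (- t))\<^sup>2 + - q (- t) * - x (- t) + p (- t) + lam) (at t)"
    by (simp add: algebra_simps)
qed

lemma flow_reversed:
  assumes "t \<in> max_interval q p lam s x0"
  shows "- t \<in> max_interval (\<lambda>t. - q (- t)) (\<lambda>t. p (- t)) lam (- s) (- x0)"
    and "flow (\<lambda>t. - q (- t)) (\<lambda>t. p (- t)) lam (- t) (- s) (- x0) = - flow q p lam t s x0"
proof -
  interpret R: riccati "\<lambda>t. - q (- t)" "\<lambda>t. p (- t)" Q P by (rule reversed)
  obtain I x where x: "solves_on q p lam I x" "s \<in> I" "t \<in> I" "x s = x0" "flow q p lam t s x0 = x t"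
    using max_interval_flow[OF assms] by metis
  show "- t \<in> max_interval (\<lambda>t. - q (- t)) (\<lambda>t. p (- t)) lam (- s) (- x0)"
    and "flow (\<lambda>t. - q (- t)) (\<lambda>t. p (- t)) lam (- t) (- s) (- x0) = - flow q p lam t s x0"
    using R.flow_eq[OF solves_on_reversed[OF x(1)], of "- s" "- t"] x by auto
qed

text \<open>The mirror image of \<open>upper_sol_maximal\<close>; the last claim is what transfers further
results from \<open>upper_sol\<close> to \<open>lower_sol\<close>.\<close>

lemma lower_sol_minimal:
  assumes x: "global_solution q p lam x"
  shows "global_solution q p lam (lower_sol q p lam)"
    and "global_solution q p lam b \<Longrightarrow> lower_sol q p lam t \<le> b t"
    and "bdd_below ((\<lambda>t. flow q p lam t s x0) ` (max_interval q p lam s x0 \<inter> {s..})) \<Longrightarrow>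
      lower_sol q p lam s \<le> x0"
    and "lower_sol q p lam t = - upper_sol (\<lambda>t. - q (- t)) (\<lambda>t. p (- t)) lam (- t)"
proof -
  let ?q = "\<lambda>t. - q (- t)" and ?p = "\<lambda>t. p (- t)"
  interpret R: riccati ?q ?p Q P by (rule reversed)
  let ?a = "upper_sol ?q ?p lam"
  define r where "r t = - ?a (- t)" for t
  note up = R.upper_sol_maximal[OF global_solution_reversed[OF x]]
  have r: "global_solution q p lam r"
    using R.global_solution_reversed[OF up(1)] by (simp add: r_def[abs_def])
  have min: "r t \<le> b t" if "global_solution q p lam b" for b t
    using up(2)[OF global_solution_reversed[OF that], of "- t"] by (simp add: r_def)
  have bdd: "r s \<le> x0"
    if bdd: "bdd_below ((\<lambda>t. flow q p lam t s x0) ` (max_interval q p lam s x0 \<inter> {s..}))" for s x0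
  proof -
    obtain K where K: "\<And>t. t \<in> max_interval q p lam s x0 \<Longrightarrow> s \<le> t \<Longrightarrow> K \<le> flow q p lam t s x0"
      using bdd by (auto simp: bdd_below_def)
    have "flow ?q ?p lam t (- s) (- x0) \<le> - K"
      if t: "t \<in> max_interval ?q ?p lam (- s) (- x0)" "t \<le> - s" for t
      using R.flow_reversed[OF t(1)] K[of "- t"] t(2) by simp
    then have "bdd_above ((\<lambda>t. flow ?q ?p lam t (- s) (- x0)) `
        (max_interval ?q ?p lam (- s) (- x0) \<inter> {..- s}))"
      by (intro bdd_aboveI2[where M = "- K"]) auto
    from up(3)[OF this] show ?thesis by (simp add: r_def)
  qed
  have eq: "lower_sol q p lam = r"
  proof
    fix s
    show "lower_sol q p lam s = r s"
      unfolding lower_sol_def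
    proof (rule Least_equality[OF _ bdd])
      have "- (2 * (Q + P + \<bar>lam\<bar>) + 1) \<le> r t" for t
        using global_solution_bound[OF r, of t] by simp
      then show "bdd_below ((\<lambda>t. flow q p lam t s (r s)) ` (max_interval q p lam s (r s) \<inter> {s..}))"
        using global_solution_flow[OF r] by (auto intro!: bdd_belowI2)
    qed
  qed
  show "global_solution q p lam (lower_sol q p lam)" using r eq by simp
  show "lower_sol q p lam t \<le> b t" if "global_solution q p lam b" using min[OF that] eq by simp
  show "lower_sol q p lam s \<le> x0"
    if "bdd_below ((\<lambda>t. flow q p lam t s x0) ` (max_interval q p lam s x0 \<inter> {s..}))"
    using bdd[OF that] eq by simp
  show "lower_sol q p lam t = - ?a (- t)" using eq by (simp add: r_def)
qed

section \<open>Exponential dichotomies\<close>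

lemma integral_variation:
  assumes b: "global_solution q p lam b" and HW: "variation q b H W"
  shows "(LBINT l=ereal s..ereal t. - 2 * b l + q l) = H t - H s"
proof (rule interval_integral_FTC_finite)
  show "continuous_on {min s t..max s t} (\<lambda>l. - 2 * b l + q l)"
    by (intro continuous_intros global_solution_continuous[OF b] continuous_on_subset[OF q_cont]) auto
  show "(H has_vector_derivative - 2 * b u + q u) (at u within {min s t..max s t})" for u
    using HW by (auto simp: variation_def has_real_derivative_iff_has_vector_derivative
        intro: has_vector_derivative_at_within)
qed

lemma attractive_pair_iff:
  assumes "global_solution q p lam b" and "variation q b H W"
  shows "attractive_pair q b k \<beta> \<longleftrightarrow>
    k \<ge> 1 \<and> \<beta> > 0 \<and> (\<forall>s t. s \<le> t \<longrightarrow> exp (H t - H s) \<le> k * exp (- \<beta> * (t - s)))"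
  unfolding attractive_pair_def integral_variation[OF assms] by simp

lemma repulsive_pair_iff:
  assumes "global_solution q p lam b" and "variation q b H W"
  shows "repulsive_pair q b k \<beta> \<longleftrightarrow>
    k \<ge> 1 \<and> \<beta> > 0 \<and> (\<forall>s t. t \<le> s \<longrightarrow> exp (H t - H s) \<le> k * exp (\<beta> * (t - s)))"
  unfolding repulsive_pair_def integral_variation[OF assms] by simp

lemma variation_reversed:
  assumes "variation q b H W"
  shows "variation (\<lambda>t. - q (- t)) (\<lambda>t. - b (- t)) (\<lambda>t. H (- t)) (\<lambda>t. - W (- t))"
proof -
  have H: "(H has_real_derivative - 2 * b t + q t) (at t)"
    and W: "(W has_real_derivative exp (H t)) (at t)" for t
    using assms by (auto simp: variation_def)
  have "((\<lambda>t. H (- t)) has_real_derivative (- 2 * b (- t) + q (- t)) * (- 1)) (at t)" for t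
    by (rule DERIV_chain2[where f = H and g = uminus, OF H]) (auto intro!: derivative_eq_intros)
  moreover have "((\<lambda>t. W (- t)) has_real_derivative exp (H (- t)) * (- 1)) (at t)" for t
    by (rule DERIV_chain2[where f = W and g = uminus, OF W]) (auto intro!: derivative_eq_intros)
  then have "((\<lambda>t. - W (- t)) has_real_derivative exp (H (- t))) (at t)" for t
    using DERIV_minus by fastforce
  ultimately show ?thesis by (simp add: variation_def)
qed

lemma repulsive_pair_reversed:
  assumes b: "global_solution q p lam b"
  shows "attractive_pair (\<lambda>t. - q (- t)) (\<lambda>t. - b (- t)) k \<beta> \<longleftrightarrow> repulsive_pair q b k \<beta>"
proof -
  interpret R: riccati "\<lambda>t. - q (- t)" "\<lambda>t. p (- t)" Q P by (rule reversed)
  obtain H W where HW: "variation q b H W" using variation_exists[OF b] .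
  have "(\<forall>s t. s \<le> t \<longrightarrow> exp (H (- t) - H (- s)) \<le> k * exp (- \<beta> * (t - s))) \<longleftrightarrow>
    (\<forall>s t. t \<le> s \<longrightarrow> exp (H t - H s) \<le> k * exp (\<beta> * (t - s)))" (is "?A \<longleftrightarrow> ?B")
  proof
    assume A: ?A
    show ?B
    proof (intro allI impI)
      fix s t :: real assume "t \<le> s"
      then show "exp (H t - H s) \<le> k * exp (\<beta> * (t - s))"
        using A[rule_format, of "- s" "- t"] by (simp add: algebra_simps)
    qed
  next
    assume B: ?B
    show ?A
    proof (intro allI impI)
      fix s t :: real assume "s \<le> t"
      then show "exp (H (- t) - H (- s)) \<le> k * exp (- \<beta> * (t - s))"
        using B[rule_format, of "- t" "- s"] by (simp add: algebra_simps)
    qed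
  qed
  then show ?thesis
    unfolding R.attractive_pair_iff[OF global_solution_reversed[OF b] variation_reversed[OF HW]]
      repulsive_pair_iff[OF b HW] by simp
qed

text \<open>The two estimates bound \<open>exp (H T - H 0)\<close> and its inverse by exponentially small terms.\<close>

lemma not_attractive_and_repulsive:
  assumes b: "global_solution q p lam b"
    and att: "attractive_pair q b k \<beta>" and rep: "repulsive_pair q b k' \<beta>'"
  shows False
proof -
  obtain H W where HW: "variation q b H W" using variation_exists[OF b] .
  note att = att[unfolded attractive_pair_iff[OF b HW]] and rep = rep[unfolded repulsive_pair_iff[OF b HW]]
  \<comment> \<open>chosen such that the product of the two estimates reads \<open>exp (k k') \<le> k k'\<close>\<close>
  define T where "T = k * k' / (\<beta> + \<beta>')"
  have T: "T \<ge> 0" "(\<beta> + \<beta>') * T = k * k'" using att rep by (auto simp: T_def)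
  have "exp (H T - H 0) \<le> k * exp (- \<beta> * (T - 0))" "exp (H 0 - H T) \<le> k' * exp (\<beta>' * (0 - T))"
    using att rep T(1) by blast+
  then have "exp (H T - H 0) * exp (H 0 - H T) \<le> (k * exp (- \<beta> * (T - 0))) * (k' * exp (\<beta>' * (0 - T)))"
    using att by (intro mult_mono) auto
  also have "\<dots> = (k * k') * exp (- ((\<beta> + \<beta>') * T))"
    by (simp add: algebra_simps exp_add exp_diff exp_minus divide_inverse)
  finally have "exp (k * k') \<le> k * k'"
    unfolding T(2) by (simp add: exp_minus field_simps flip: exp_add)
  then show False using exp_ge_add_one_self[of "k * k'"] by linarith
qed

text \<open>The logarithmic derivative of \<open>c - b\<close> is \<open>q - 2 c + (c - b)\<close>, so up to the bounded function \<open>ln (c - b)\<close> the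
integral of \<open>q - 2 c\<close> is the integral of \<open>- (c - b) \<le> - \<delta>\<close>. The proof uses the monotonicity of
\<open>exp (H + \<delta> t) / (c - b)\<close>.\<close>

lemma separated_solution_attractive:
  assumes b: "global_solution q p lam b" and c: "global_solution q p lam c"
    and "\<delta> > 0" and sep: "\<And>t. b t + \<delta> \<le> c t"
  shows "\<exists>k. attractive_pair q c k \<delta>"
proof -
  define M where "M = 2 * (Q + P + \<bar>lam\<bar>) + 1"
  obtain H W where HW: "variation q c H W" using variation_exists[OF c] .
  have dH: "(H has_real_derivative - 2 * c t + q t) (at t)"
    and db: "(b has_real_derivative - (b t)\<^sup>2 + q t * b t + p t + lam) (at t)"
    and dc: "(c has_real_derivative - (c t)\<^sup>2 + q t * c t + p t + lam) (at t)" for t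
    using HW b c by (auto simp: variation_def global_solution_iff)
  have gap: "\<delta> \<le> c t - b t" "c t - b t \<le> 2 * M" "c t - b t > 0" for t
    using sep[of t] \<open>\<delta> > 0\<close> global_solution_bound[OF b, of t] global_solution_bound[OF c, of t]
    by (auto simp: M_def)
  have "exp (H t - H s) \<le> 2 * M / \<delta> * exp (- \<delta> * (t - s))" if "s \<le> t" for s t
  proof -
    have "exp (H t + \<delta> * t) / (c t - b t) \<le> exp (H s + \<delta> * s) / (c s - b s)"
    proof (rule DERIV_nonpos_imp_nonincreasing[where f = "\<lambda>t. exp (H t + \<delta> * t) / (c t - b t)", OF that])
      fix u
      define D where "D = c u - b u"
      have D: "D \<ge> \<delta>" "D > 0" using gap[of u] by (auto simp: D_def)
      have "((\<lambda>t. exp (H t + \<delta> * t) / (c t - b t)) has_real_derivative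
        (exp (H u + \<delta> * u) * (- 2 * c u + q u + \<delta>) * D
          - exp (H u + \<delta> * u) * ((- (c u)\<^sup>2 + q u * c u + p u + lam) - (- (b u)\<^sup>2 + q u * b u + p u + lam)))
        / (D * D)) (at u)"
        using D unfolding D_def by (auto intro!: derivative_eq_intros dH db dc)
      moreover have "(exp (H u + \<delta> * u) * (- 2 * c u + q u + \<delta>) * D
          - exp (H u + \<delta> * u) * ((- (c u)\<^sup>2 + q u * c u + p u + lam) - (- (b u)\<^sup>2 + q u * b u + p u + lam)))
          = exp (H u + \<delta> * u) * (D * (\<delta> - D))"
        by (simp add: D_def power2_eq_square algebra_simps)
      moreover have "exp (H u + \<delta> * u) * (D * (\<delta> - D)) / (D * D) \<le> 0"
        using D by (simp add: divide_nonpos_nonneg mult_le_0_iff)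
      ultimately show "\<exists>y. ((\<lambda>t. exp (H t + \<delta> * t) / (c t - b t)) has_real_derivative y) (at u) \<and> y \<le> 0"
        by auto
    qed
    then have "exp (H t - H s) \<le> ((c t - b t) / (c s - b s)) * exp (- \<delta> * (t - s))"
      using gap(3)[of t] gap(3)[of s]
      by (simp add: field_simps exp_add exp_diff exp_minus)
    also have "\<dots> \<le> 2 * M / \<delta> * exp (- \<delta> * (t - s))"
      using gap[of t] gap[of s] \<open>\<delta> > 0\<close> by (intro mult_right_mono frac_le) auto
    finally show ?thesis .
  qed
  moreover have "2 * M / \<delta> \<ge> 1" using gap[of 0] \<open>\<delta> > 0\<close> by simp
  ultimately show ?thesis
    using \<open>\<delta> > 0\<close> unfolding attractive_pair_iff[OF c HW] by blast
qed

lemma separated_solution_repulsive: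
  assumes b: "global_solution q p lam b" and c: "global_solution q p lam c"
    and "\<delta> > 0" and sep: "\<And>t. b t + \<delta> \<le> c t"
  shows "\<exists>k. repulsive_pair q b k \<delta>"
proof -
  interpret R: riccati "\<lambda>t. - q (- t)" "\<lambda>t. p (- t)" Q P by (rule reversed)
  have "- c (- t) + \<delta> \<le> - b (- t)" for t using sep[of "- t"] by simp
  from R.separated_solution_attractive[OF global_solution_reversed[OF c] global_solution_reversed[OF b]
      \<open>\<delta> > 0\<close> this]
  show ?thesis by (simp add: repulsive_pair_reversed[OF b])
qed

text \<open>If \<open>b\<close> were strictly below the maximal solution \<open>a\<close>, then \<open>exp H / (a - b)\<close> would be nondecreasing, so
\<open>a - b\<close> would contract forwards as fast as \<open>exp H\<close>, and would hence be unbounded in the past.\<close>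

lemma attractive_eq_upper_sol:
  assumes b: "global_solution q p lam b" and att: "attractive_pair q b k \<beta>"
  shows "b = upper_sol q p lam"
proof (rule ccontr)
  define a where "a = upper_sol q p lam"
  define M where "M = 2 * (Q + P + \<bar>lam\<bar>) + 1"
  assume "b \<noteq> upper_sol q p lam"
  then have ne: "b \<noteq> a" by (simp add: a_def)
  have a: "global_solution q p lam a" and le: "b t \<le> a t" for t
    using upper_sol_maximal[OF b] b by (auto simp: a_def)
  have pos: "a t - b t > 0" for t
    using le[of t] global_solution_unique[OF b a, of t] ne by (cases "b t = a t") auto
  have upper: "a t - b t \<le> 2 * M" for t
    using global_solution_bound[OF b, of t] global_solution_bound[OF a, of t] by (auto simp: M_def)
  obtain H W where HW: "variation q b H W" using variation_exists[OF b] .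
  note att = att[unfolded attractive_pair_iff[OF b HW]]
  have dH: "(H has_real_derivative - 2 * b t + q t) (at t)"
    and db: "(b has_real_derivative - (b t)\<^sup>2 + q t * b t + p t + lam) (at t)"
    and da: "(a has_real_derivative - (a t)\<^sup>2 + q t * a t + p t + lam) (at t)" for t
    using HW b a by (auto simp: variation_def global_solution_iff)
  have mono: "exp (H s) / (a s - b s) \<le> exp (H t) / (a t - b t)" if "s \<le> t" for s t
  proof (rule DERIV_nonneg_imp_nondecreasing[where f = "\<lambda>t. exp (H t) / (a t - b t)", OF that])
    fix u
    define D where "D = a u - b u"
    have D: "D > 0" using pos[of u] by (auto simp: D_def)
    have "((\<lambda>t. exp (H t) / (a t - b t)) has_real_derivative
      (exp (H u) * (- 2 * b u + q u) * D
        - exp (H u) * ((- (a u)\<^sup>2 + q u * a u + p u + lam) - (- (b u)\<^sup>2 + q u * b u + p u + lam)))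
      / (D * D)) (at u)"
      using D unfolding D_def by (auto intro!: derivative_eq_intros dH db da)
    moreover have "(exp (H u) * (- 2 * b u + q u) * D
        - exp (H u) * ((- (a u)\<^sup>2 + q u * a u + p u + lam) - (- (b u)\<^sup>2 + q u * b u + p u + lam)))
        = exp (H u) * (D * D)"
      by (simp add: D_def power2_eq_square algebra_simps)
    moreover have "exp (H u) * (D * D) / (D * D) \<ge> 0" by simp
    ultimately show "\<exists>y. ((\<lambda>t. exp (H t) / (a t - b t)) has_real_derivative y) (at u) \<and> 0 \<le> y"
      by auto
  qed
  define y where "y = a 0 - b 0"
  define X where "X = 2 * M * k / y"
  have y: "y > 0" using pos by (simp add: y_def)
  have M: "M > 0" using upper[of 0] y by (simp add: y_def)
  have X: "X > 0" "X * y = 2 * M * k" using y att M by (auto simp: X_def)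
  \<comment> \<open>a time in the past by which the contraction exceeds what the bound on \<open>a - b\<close> allows\<close>
  define s where "s = - (X / \<beta>)"
  have s: "s \<le> 0" "\<beta> * s = - X" using X att by (auto simp: s_def)
  have "y / (a s - b s) \<le> exp (H 0 - H s)"
    using mono[OF s(1)] pos[of s] y by (simp add: y_def exp_diff field_simps)
  also have "\<dots> \<le> k * exp (- \<beta> * (0 - s))"
    using att s(1) by blast
  also have "\<dots> = k * exp (- X)" using s(2) by simp
  finally have "y * exp X \<le> k * (a s - b s)"
    using pos[of s] by (simp add: exp_minus field_simps)
  also have "\<dots> \<le> k * (2 * M)" using upper[of s] att by (intro mult_left_mono) auto
  finally have "y * exp X \<le> X * y" unfolding X(2) by (simp add: ac_simps)
  then have "exp X \<le> X" using y by simp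
  then show False using exp_ge_add_one_self[of X] by linarith
qed

lemma repulsive_eq_lower_sol:
  assumes b: "global_solution q p lam b" and rep: "repulsive_pair q b k \<beta>"
  shows "b = lower_sol q p lam"
proof
  fix t
  interpret R: riccati "\<lambda>t. - q (- t)" "\<lambda>t. p (- t)" Q P by (rule reversed)
  have "attractive_pair (\<lambda>t. - q (- t)) (\<lambda>t. - b (- t)) k \<beta>"
    using rep by (simp add: repulsive_pair_reversed[OF b])
  from R.attractive_eq_upper_sol[OF global_solution_reversed[OF b] this]
  have "- b (- (- t)) = upper_sol (\<lambda>t. - q (- t)) (\<lambda>t. p (- t)) lam (- t)" by (rule fun_cong)
  then show "b t = lower_sol q p lam t"
    using lower_sol_minimal(4)[OF b] by simp
qed

section \<open>Dependence on the parameter\<close>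

text \<open>A solution \<open>x\<close> for the smaller parameter is a lower solution for the larger one. The distance \<open>d\<close> to the
maximal solution satisfies \<open>d' \<ge> - C d + (lam2 - lam1)\<close>, which keeps it away from zero uniformly.\<close>

lemma upper_sol_strict_mono:
  assumes x: "global_solution q p lam1 x" and "lam1 < lam2"
  shows "global_solution q p lam2 (upper_sol q p lam2)"
    and "\<exists>\<eta>>0. \<forall>t. x t + \<eta> \<le> upper_sol q p lam2 t"
proof -
  have dx: "(x has_real_derivative - (x t)\<^sup>2 + q t * x t + p t + lam1) (at t)" for t
    using x by (simp add: global_solution_iff)
  obtain a where a: "global_solution q p lam2 a" and le: "\<And>t. x t \<le> a t"
    and max: "\<And>b t. global_solution q p lam2 b \<Longrightarrow> b t \<le> a t"
    using maximal_solution_above_lower_solution[OF dx, of lam2 "2 * (Q + P + \<bar>lam1\<bar>) + 1"]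
      global_solution_bound[OF x] \<open>lam1 < lam2\<close> by auto
  have eq: "upper_sol q p lam2 = a" using a max by (rule upper_sol_eq_maximal)
  show "global_solution q p lam2 (upper_sol q p lam2)" using a eq by simp
  define C where "C = Q + (2 * (Q + P + \<bar>lam1\<bar>) + 1) + (2 * (Q + P + \<bar>lam2\<bar>) + 1)"
  have "Q \<ge> 0" "P \<ge> 0" using q_bound[of 0] p_bound[of 0] by linarith+
  then have C: "C > 0" by (simp add: C_def)
  have da: "(a has_real_derivative - (a t)\<^sup>2 + q t * a t + p t + lam2) (at t)" for t
    using a by (simp add: global_solution_iff)
  have "(lam2 - lam1) / C \<le> a t - x t" for t
  proof (rule linear_differential_lower_bound[OF DERIV_diff[OF da dx] _ _ C])
    fix u
    show "0 \<le> a u - x u" using le by simp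
    have "- C \<le> q u - a u - x u"
      using q_bound[of u] global_solution_bound[OF x, of u] global_solution_bound[OF a, of u]
      unfolding C_def by linarith
    then have "- C * (a u - x u) \<le> (q u - a u - x u) * (a u - x u)"
      using le[of u] by (intro mult_right_mono) auto
    then show "- C * (a u - x u) + (lam2 - lam1) \<le>
        - (a u)\<^sup>2 + q u * a u + p u + lam2 - (- (x u)\<^sup>2 + q u * x u + p u + lam1)"
      by (simp add: power2_eq_square algebra_simps)
  qed
  then show "\<exists>\<eta>>0. \<forall>t. x t + \<eta> \<le> upper_sol q p lam2 t"
    using C \<open>lam1 < lam2\<close> eq by (intro exI[of _ "(lam2 - lam1) / C"]) (auto simp: algebra_simps)
qed

lemma lower_sol_strict_mono:
  assumes x: "global_solution q p lam1 x" and "lam1 < lam2"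
  shows "\<exists>\<eta>>0. \<forall>t. lower_sol q p lam2 t \<le> x t - \<eta>"
proof -
  interpret R: riccati "\<lambda>t. - q (- t)" "\<lambda>t. p (- t)" Q P by (rule reversed)
  obtain \<eta> where \<eta>: "\<eta> > 0" "\<And>t. - x (- t) + \<eta> \<le> upper_sol (\<lambda>t. - q (- t)) (\<lambda>t. p (- t)) lam2 t"
    using R.upper_sol_strict_mono(2)[OF global_solution_reversed[OF x] \<open>lam1 < lam2\<close>] by blast
  have "lower_sol q p lam2 t \<le> x t - \<eta>" for t
    using \<eta>(2)[of "- t"] lower_sol_minimal(4)[OF upper_sol_strict_mono(1)[OF assms], of t] by simp
  then show ?thesis using \<eta>(1) by blast
qed

text \<open>The average of two solutions is a lower solution, by strict concavity of the right-hand side: it gains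
\<open>(c - b)\<^sup>2 / 4\<close>.\<close>

lemma solution_from_separated_pair:
  assumes b: "global_solution q p lam b" and c: "global_solution q p lam c"
    and "\<delta> > 0" and sep: "\<And>t. b t + \<delta> \<le> c t"
  shows "\<exists>x. global_solution q p (lam - \<delta>\<^sup>2 / 4) x"
proof -
  define M where "M = 2 * (Q + P + \<bar>lam\<bar>) + 1"
  have db: "(b has_real_derivative - (b t)\<^sup>2 + q t * b t + p t + lam) (at t)"
    and dc: "(c has_real_derivative - (c t)\<^sup>2 + q t * c t + p t + lam) (at t)" for t
    using b c by (auto simp: global_solution_iff)
  have deriv: "((\<lambda>t. (b t + c t) / 2) has_real_derivative
      ((- (b t)\<^sup>2 + q t * b t + p t + lam) + (- (c t)\<^sup>2 + q t * c t + p t + lam)) / 2) (at t)" for t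
    by (intro DERIV_cdivide DERIV_add db dc)
  have lower: "((- (b t)\<^sup>2 + q t * b t + p t + lam) + (- (c t)\<^sup>2 + q t * c t + p t + lam)) / 2
      \<le> - ((b t + c t) / 2)\<^sup>2 + q t * ((b t + c t) / 2) + p t + (lam - \<delta>\<^sup>2 / 4)" for t
  proof -
    have "\<delta>\<^sup>2 \<le> (c t - b t)\<^sup>2" using sep[of t] \<open>\<delta> > 0\<close> by (intro power_mono) auto
    then show ?thesis by (simp add: power2_eq_square field_simps)
  qed
  have bound: "\<bar>(b t + c t) / 2\<bar> \<le> M" for t
    using global_solution_bound[OF b, of t] global_solution_bound[OF c, of t] by (auto simp: M_def)
  obtain x where "global_solution q p (lam - \<delta>\<^sup>2 / 4) x"
    by (rule maximal_solution_above_lower_solution[OF deriv lower bound])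
  then show ?thesis by blast
qed

text \<open>Hyperbolicity is robust. A lower solution \<open>b - \<rho> h\<close> for a smaller parameter needs a bounded \<open>h \<ge> 0\<close> with
\<open>h' \<ge> (q - 2 b) h + 1 / 2\<close>. The bounded solution of \<open>h' = (q - 2 b) h + 1\<close> would be the integral of
\<open>exp (H t - H u)\<close> over all \<open>u \<le> t\<close>. A finite window \<open>{t - N..t}\<close> suffices, once \<open>N\<close> is so large that the
contraction over the window is at most \<open>1 / 2\<close>.\<close>

lemma solution_from_attractive:
  assumes b: "global_solution q p lam b" and att: "attractive_pair q b k \<beta>"
  shows "\<exists>\<eta>>0. \<exists>x. global_solution q p (lam - \<eta>) x"
proof -
  define M where "M = 2 * (Q + P + \<bar>lam\<bar>) + 1"
  obtain H W where HW: "variation q b H W" using variation_exists[OF b] .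
  note att = att[unfolded attractive_pair_iff[OF b HW]]
  then have k: "k \<ge> 1" and \<beta>: "\<beta> > 0"
    and decay: "\<And>s t. s \<le> t \<Longrightarrow> exp (H t - H s) \<le> k * exp (- \<beta> * (t - s))" by auto
  have dH: "(H has_real_derivative - 2 * b t + q t) (at t)"
    and db: "(b has_real_derivative - (b t)\<^sup>2 + q t * b t + p t + lam) (at t)" for t
    using HW b by (auto simp: variation_def global_solution_iff)
  have "continuous_on UNIV (\<lambda>t. exp (- H t))"
    by (intro continuous_intros continuous_on_of_derivative[OF dH])
  then obtain V where dV: "\<And>t. (V has_real_derivative exp (- H t)) (at t)"
    by (rule antiderivative_exists) blast
  define N where "N = 2 * k / \<beta>"
  have N: "N > 0" "\<beta> * N = 2 * k" using k \<beta> by (auto simp: N_def)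
  define h where "h t = exp (H t) * (V t - V (t - N))" for t
  have "2 * k \<le> exp (2 * k)"
    using exp_ge_add_one_self[of "2 * k"] by linarith
  then have "k * exp (- (2 * k)) \<le> 1 / 2"
    by (simp add: exp_minus field_simps)
  then have half: "exp (H t - H (t - N)) \<le> 1 / 2" for t
    using decay[of "t - N" t] N by simp
  have h_bounds: "0 \<le> h t" "h t \<le> N * k" for t
  proof -
    obtain z where z: "t - N < z" "z < t" "V t - V (t - N) = (t - (t - N)) * exp (- H z)"
      using MVT2[of "t - N" t V "\<lambda>t. exp (- H t)"] dV N by auto
    then have h: "h t = N * exp (H t - H z)"
      unfolding h_def z(3) by (simp add: exp_diff exp_minus divide_inverse)
    have "exp (H t - H z) \<le> k * exp (- \<beta> * (t - z))" using decay z by simp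
    also have "\<dots> \<le> k * 1" using k \<beta> z by (intro mult_left_mono) auto
    finally show "0 \<le> h t" "h t \<le> N * k" using h N by auto
  qed
  define h' where "h' t = (- 2 * b t + q t) * h t + 1 - exp (H t - H (t - N))" for t
  have dh: "(h has_real_derivative h' t) (at t)" for t
  proof -
    have "((\<lambda>t. V (t - N)) has_real_derivative exp (- H (t - N)) * 1) (at t)"
      by (rule DERIV_chain2[where f = V and g = "\<lambda>t. t - N", OF dV])
        (auto intro!: derivative_eq_intros)
    then have "(h has_real_derivative exp (H t) * (- 2 * b t + q t) * (V t - V (t - N))
        + (exp (- H t) - exp (- H (t - N)) * 1) * exp (H t)) (at t)"
      unfolding h_def[abs_def] by (intro DERIV_mult' DERIV_mult DERIV_diff DERIV_fun_exp dH dV)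
    moreover have "exp (H t) * (- 2 * b t + q t) * (V t - V (t - N))
        + (exp (- H t) - exp (- H (t - N)) * 1) * exp (H t) = h' t"
      by (simp add: h'_def h_def algebra_simps exp_diff exp_minus divide_inverse)
    ultimately show ?thesis by simp
  qed
  \<comment> \<open>so small that the quadratic term \<open>\<rho>\<^sup>2 h\<^sup>2\<close> uses up at most half of the gain \<open>\<rho> / 2\<close>\<close>
  define \<rho> where "\<rho> = 1 / (4 * (N * k)\<^sup>2)"
  have \<rho>: "\<rho> > 0" "\<rho> * (N * k)\<^sup>2 = 1 / 4" using N k by (auto simp: \<rho>_def)
  have deriv: "((\<lambda>t. b t - \<rho> * h t) has_real_derivative
      (- (b t)\<^sup>2 + q t * b t + p t + lam) - \<rho> * h' t) (at t)" for t
    by (intro DERIV_diff db DERIV_cmult dh)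
  have lower: "(- (b t)\<^sup>2 + q t * b t + p t + lam) - \<rho> * h' t
      \<le> - (b t - \<rho> * h t)\<^sup>2 + q t * (b t - \<rho> * h t) + p t + (lam - \<rho> / 4)" for t
  proof -
    have "\<rho> * (h t)\<^sup>2 \<le> \<rho> * (N * k)\<^sup>2"
      using h_bounds[of t] \<rho> by (intro mult_left_mono power_mono) auto
    then have "\<rho> * (\<rho> * (h t)\<^sup>2) \<le> \<rho> * (1 / 4)"
      using \<rho> by (intro mult_left_mono) auto
    moreover have "\<rho> * exp (H t - H (t - N)) \<le> \<rho> * (1 / 2)"
      using half[of t] \<rho> by (intro mult_left_mono) auto
    ultimately show ?thesis
      unfolding h'_def by (simp add: power2_eq_square algebra_simps)
  qed
  have bound: "\<bar>b t - \<rho> * h t\<bar> \<le> M + \<rho> * (N * k)" for t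
  proof -
    have "0 \<le> \<rho> * h t" "\<rho> * h t \<le> \<rho> * (N * k)" using h_bounds[of t] \<rho> by auto
    then show ?thesis using global_solution_bound[OF b, of t] by (auto simp: M_def)
  qed
  obtain x where "global_solution q p (lam - \<rho> / 4) x"
    by (rule maximal_solution_above_lower_solution[OF deriv lower bound])
  moreover have "\<rho> / 4 > 0" using \<rho> by simp
  ultimately show ?thesis by blast
qed

lemma solution_from_hyperbolic:
  assumes "hyperbolic q p lam b"
  shows "\<exists>\<eta>>0. \<exists>x. global_solution q p (lam - \<eta>) x"
proof -
  interpret R: riccati "\<lambda>t. - q (- t)" "\<lambda>t. p (- t)" Q P by (rule reversed)
  obtain k \<beta> where b: "global_solution q p lam b" and dich: "dichotomy_pair q b k \<beta>"
    using assms by (auto simp: hyperbolic_def)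
  show ?thesis
  proof (cases "attractive_pair q b k \<beta>")
    case True
    with b show ?thesis by (rule solution_from_attractive)
  next
    case False
    then have "attractive_pair (\<lambda>t. - q (- t)) (\<lambda>t. - b (- t)) k \<beta>"
      using dich by (simp add: dichotomy_pair_def repulsive_pair_reversed[OF b])
    from R.solution_from_attractive[OF global_solution_reversed[OF b] this] obtain \<eta> x where "\<eta> > 0"
      "global_solution (\<lambda>t. - q (- t)) (\<lambda>t. p (- t)) (lam - \<eta>) x" by blast
    with R.global_solution_reversed[of "lam - \<eta>" x] show ?thesis by auto
  qed
qed

text \<open>The maximal solutions for parameters decreasing to \<open>lam\<close> decrease, and they are uniformly bounded.\<close>

lemma solution_at_infimum:
  assumes sol: "\<And>lam'. lam' > lam \<Longrightarrow> \<exists>x. global_solution q p lam' x"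
  shows "\<exists>x. global_solution q p lam x"
proof -
  define l where "l n = lam + inverse (real (Suc n))" for n
  define F where "F n = upper_sol q p (l n)" for n
  define M where "M = 2 * (Q + P + (\<bar>lam\<bar> + 1)) + 1"
  have l: "lam < l n" "\<bar>l n\<bar> \<le> \<bar>lam\<bar> + 1" "l (Suc n) < l n" for n
  proof -
    have "0 < inverse (real (Suc n))" "inverse (real (Suc n)) \<le> 1"
      "inverse (real (Suc (Suc n))) < inverse (real (Suc n))"
      by (auto simp: inverse_le_1_iff)
    then show "lam < l n" "\<bar>l n\<bar> \<le> \<bar>lam\<bar> + 1" "l (Suc n) < l n"
      unfolding l_def by linarith+
  qed
  have F: "global_solution q p (l n) (F n)" for n
    using sol[OF l(1)] upper_sol_maximal(1) unfolding F_def by blast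
  have FM: "\<bar>F n t\<bar> \<le> M" for n t
    using global_solution_bound[OF F, of n t] l(2)[of n] by (simp add: M_def)
  have dec: "F (Suc n) t \<le> F n t" for n t
  proof -
    obtain \<eta> where "\<eta> > 0" "F (Suc n) t + \<eta> \<le> F n t"
      using upper_sol_strict_mono(2)[OF F l(3)] unfolding F_def[symmetric] by blast
    then show ?thesis by linarith
  qed
  have "convergent (\<lambda>n. F n t)" for t
  proof (rule Bseq_monoseq_convergent)
    show "Bseq (\<lambda>n. F n t)" using FM by (intro BseqI'[of _ M]) simp
    show "monoseq (\<lambda>n. F n t)" using dec by (simp add: monoseq_Suc)
  qed
  then obtain x where lim: "\<And>t. (\<lambda>n. F n t) \<longlonglongrightarrow> x t"
    unfolding convergent_def by metis
  have "l \<longlonglongrightarrow> lam + 0"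
    unfolding l_def by (intro tendsto_intros LIMSEQ_inverse_real_of_nat)
  then have "global_solution q p lam x"
    using F FM lim l(2) global_solution_continuous[OF F]
    by (intro limit_of_approximate_solutions[where f = F and g = F and c = 0 and l = l and M = M
          and R = "\<bar>lam\<bar> + 1"]) (auto simp: global_solution_iff)
  then show ?thesis by blast
qed

lemma constant_below_upper_sol:
  assumes "N \<ge> 0" and "\<And>t. N\<^sup>2 \<le> q t * N + p t + lam"
  shows "global_solution q p lam (upper_sol q p lam)" and "N \<le> upper_sol q p lam t"
proof -
  obtain a where a: "global_solution q p lam a" and le: "\<And>t. N \<le> a t"
    and max: "\<And>b t. global_solution q p lam b \<Longrightarrow> b t \<le> a t"
  proof (rule maximal_solution_above_lower_solution[of "\<lambda>_. N" "\<lambda>_. 0" lam N])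
    show "0 \<le> - N\<^sup>2 + q t * N + p t + lam" for t using assms(2)[of t] by simp
  qed (use assms(1) in auto)
  have eq: "upper_sol q p lam = a" using a max by (rule upper_sol_eq_maximal)
  show "global_solution q p lam (upper_sol q p lam)" "N \<le> upper_sol q p lam t" using a le eq by auto
qed

text \<open>For large \<open>lam\<close> the constant \<open>\<bar>M\<bar> + 1\<close> is a lower solution.\<close>

lemma upper_sol_unbounded:
  "eventually (\<lambda>lam. global_solution q p lam (upper_sol q p lam) \<and> (\<forall>t. upper_sol q p lam t > M)) at_top"
proof -
  define N where "N = \<bar>M\<bar> + 1"
  have N: "N \<ge> 0" "M < N" by (auto simp: N_def)
  show ?thesis
  proof (rule eventually_mono[OF eventually_ge_at_top[of "N\<^sup>2 + Q * N + P"]])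
    fix lam assume lam: "N\<^sup>2 + Q * N + P \<le> lam"
    have "N\<^sup>2 \<le> q t * N + p t + lam" for t
    proof -
      have "- Q * N \<le> q t * N" using q_bound[of t] N by (intro mult_right_mono) auto
      then show ?thesis using lam p_bound[of t] by simp
    qed
    from constant_below_upper_sol[OF N(1) this]
    show "global_solution q p lam (upper_sol q p lam) \<and> (\<forall>t. upper_sol q p lam t > M)"
      using N(2) by (auto intro: less_le_trans)
  qed
qed

lemma lower_sol_unbounded:
  "eventually (\<lambda>lam. \<forall>t. lower_sol q p lam t < M) at_top"
proof -
  interpret R: riccati "\<lambda>t. - q (- t)" "\<lambda>t. p (- t)" Q P by (rule reversed)
  from upper_sol_unbounded[of 0] R.upper_sol_unbounded[of "- M"] show ?thesis
  proof eventually_elim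
    case (elim lam)
    then have "lower_sol q p lam t = - upper_sol (\<lambda>t. - q (- t)) (\<lambda>t. p (- t)) lam (- t)" for t
      by (intro lower_sol_minimal(4)) auto
    then show ?case using elim(2) by (metis minus_less_iff)
  qed
qed

section \<open>Asymptotic dynamics\<close>

text \<open>The contraction \<open>exp (H t - H s)\<close> of the linearisation is inherited by the flow wherever the denominator of
the explicit formula stays away from zero.\<close>

lemma flow_estimate:
  assumes a: "global_solution q p lam a" and HW: "variation q a H W" and "m > 0"
    and pos: "m \<le> 1 + (x0 - a s) * exp (- H s) * (W t - W s)"
  shows "t \<in> max_interval q p lam s x0"
    and "\<bar>a t - flow q p lam t s x0\<bar> \<le> exp (H t - H s) * \<bar>a s - x0\<bar> / m"
proof -
  define D where "D = 1 + (x0 - a s) * exp (- H s) * (W t - W s)"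
  have D: "m \<le> D" "D > 0" using pos \<open>m > 0\<close> by (auto simp: D_def)
  note flow = flow_from_known_solution[OF a HW D(2)[unfolded D_def], folded D_def]
  show "t \<in> max_interval q p lam s x0" by (rule flow(1))
  have "\<bar>a t - flow q p lam t s x0\<bar> = exp (H t - H s) * \<bar>a s - x0\<bar> / D"
    unfolding flow(2) using D(2) by (simp add: abs_mult abs_minus_commute)
  also have "\<dots> \<le> exp (H t - H s) * \<bar>a s - x0\<bar> / m"
    using D \<open>m > 0\<close> by (intro divide_left_mono) auto
  finally show "\<bar>a t - flow q p lam t s x0\<bar> \<le> exp (H t - H s) * \<bar>a s - x0\<bar> / m" .
qed

lemma attraction_from_above:
  assumes a: "global_solution q p lam a" and att: "attractive_pair q a k \<beta>"
    and "a s \<le> x0" "s \<le> t"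
  shows "\<bar>a t - flow q p lam t s x0\<bar> \<le> k * exp (- \<beta> * (t - s)) * \<bar>a s - x0\<bar>"
proof -
  obtain H W where HW: "variation q a H W" using variation_exists[OF a] .
  have "0 \<le> (x0 - a s) * exp (- H s) * (W t - W s)"
    using variation_mono[OF HW \<open>s \<le> t\<close>] \<open>a s \<le> x0\<close> by simp
  then have "\<bar>a t - flow q p lam t s x0\<bar> \<le> exp (H t - H s) * \<bar>a s - x0\<bar> / 1"
    by (intro flow_estimate[OF a HW]) auto
  also have "\<dots> = exp (H t - H s) * \<bar>a s - x0\<bar>" by simp
  also have "\<dots> \<le> k * exp (- \<beta> * (t - s)) * \<bar>a s - x0\<bar>"
    using att \<open>s \<le> t\<close> unfolding attractive_pair_iff[OF a HW] by (intro mult_right_mono) auto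
  finally show ?thesis .
qed

text \<open>Inserting \<open>r\<close> into the explicit formula based on \<open>a\<close> shows that \<open>exp H / (a - r) + W\<close> is constant, so that
\<open>exp (- H s) (W t - W s)\<close> stays below \<open>1 / (a s - r s)\<close>. A solution starting \<open>\<epsilon>\<close> above \<open>r\<close> therefore has a
denominator of at least \<open>\<epsilon> / (a s - r s)\<close>.\<close>

lemma attraction_above_repeller:
  assumes a: "global_solution q p lam a" and r: "global_solution q p lam r"
    and less: "\<And>t. r t < a t" and gap: "\<And>t. a t - r t \<le> C"
    and att: "attractive_pair q a k \<beta>"
    and "\<epsilon> > 0" "r s + \<epsilon> \<le> x0" "s \<le> t"
  shows "t \<in> max_interval q p lam s x0"
    and "\<bar>a t - flow q p lam t s x0\<bar> \<le> k * (1 + C / \<epsilon>) * exp (- \<beta> * (t - s)) * \<bar>a s - x0\<bar>"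
proof -
  obtain H W where HW: "variation q a H W" using variation_exists[OF a] .
  have dH: "(H has_real_derivative - 2 * a t + q t) (at t)"
    and dW: "(W has_real_derivative exp (H t)) (at t)"
    and da: "(a has_real_derivative - (a t)\<^sup>2 + q t * a t + p t + lam) (at t)"
    and dr: "(r has_real_derivative - (r t)\<^sup>2 + q t * r t + p t + lam) (at t)" for t
    using HW a r by (auto simp: variation_def global_solution_iff)
  have "((\<lambda>t. exp (H t) / (a t - r t) + W t) has_real_derivative 0) (at u)" for u
  proof -
    define d where "d = a u - r u"
    have d: "d > 0" using less[of u] by (simp add: d_def)
    have "((\<lambda>t. exp (H t) / (a t - r t) + W t) has_real_derivative
      (exp (H u) * (- 2 * a u + q u) * d
        - exp (H u) * ((- (a u)\<^sup>2 + q u * a u + p u + lam) - (- (r u)\<^sup>2 + q u * r u + p u + lam)))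
      / (d * d) + exp (H u)) (at u)"
      using d unfolding d_def by (auto intro!: derivative_eq_intros dH dW da dr)
    moreover have "(exp (H u) * (- 2 * a u + q u) * d
        - exp (H u) * ((- (a u)\<^sup>2 + q u * a u + p u + lam) - (- (r u)\<^sup>2 + q u * r u + p u + lam)))
        = - exp (H u) * (d * d)"
      by (simp add: d_def power2_eq_square algebra_simps)
    ultimately show ?thesis using d by simp
  qed
  then have const: "exp (H t) / (a t - r t) + W t = exp (H s) / (a s - r s) + W s"
    by (intro DERIV_isconst_all) blast
  have C: "C > 0" using less[of s] gap[of s] by linarith
  define D where "D = 1 + (x0 - a s) * exp (- H s) * (W t - W s)"
  have Wst: "0 \<le> W t - W s" using variation_mono[OF HW \<open>s \<le> t\<close>] by simp
  have m: "1 / (1 + C / \<epsilon>) = \<epsilon> / (\<epsilon> + C)" using \<open>\<epsilon> > 0\<close> C by (simp add: field_simps)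
  have "1 / (1 + C / \<epsilon>) \<le> D"
  proof (cases "a s \<le> x0")
    case True
    then have "1 \<le> D" using Wst by (simp add: D_def)
    moreover have "1 / (1 + C / \<epsilon>) \<le> 1" using \<open>\<epsilon> > 0\<close> C by (simp add: m)
    ultimately show ?thesis by linarith
  next
    case False
    define d where "d = a s - r s"
    have d: "0 < d" "d \<le> C" using less[of s] gap[of s] by (auto simp: d_def)
    have "exp (H t) / (a t - r t) > 0" using less[of t] by simp
    then have "W t - W s \<le> exp (H s) / d" using const by (simp add: d_def)
    then have "exp (- H s) * (W t - W s) \<le> exp (- H s) * (exp (H s) / d)"
      by (intro mult_left_mono) auto
    also have "\<dots> = 1 / d" by (simp add: exp_minus)
    finally have "(a s - x0) * (exp (- H s) * (W t - W s)) \<le> (d - \<epsilon>) * (1 / d)"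
      using False \<open>r s + \<epsilon> \<le> x0\<close> Wst by (intro mult_mono) (auto simp: d_def)
    also have "\<dots> = 1 - \<epsilon> / d" using d by (simp add: field_simps)
    finally have "\<epsilon> / d \<le> D" by (simp add: D_def algebra_simps)
    moreover have "\<epsilon> / (\<epsilon> + C) \<le> \<epsilon> / d"
      using d \<open>\<epsilon> > 0\<close> by (intro divide_left_mono) auto
    ultimately show ?thesis unfolding m by linarith
  qed
  moreover have "0 < 1 / (1 + C / \<epsilon>)" using \<open>\<epsilon> > 0\<close> C by (simp add: m)
  ultimately have est: "t \<in> max_interval q p lam s x0"
    "\<bar>a t - flow q p lam t s x0\<bar> \<le> exp (H t - H s) * \<bar>a s - x0\<bar> / (1 / (1 + C / \<epsilon>))"
    using flow_estimate[OF a HW] unfolding D_def by blast+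
  show "t \<in> max_interval q p lam s x0" by (rule est(1))
  have "exp (H t - H s) * \<bar>a s - x0\<bar> / (1 / (1 + C / \<epsilon>)) = exp (H t - H s) * ((1 + C / \<epsilon>) * \<bar>a s - x0\<bar>)"
    by simp
  also have "\<dots> \<le> (k * exp (- \<beta> * (t - s))) * ((1 + C / \<epsilon>) * \<bar>a s - x0\<bar>)"
    using att \<open>s \<le> t\<close> \<open>\<epsilon> > 0\<close> C unfolding attractive_pair_iff[OF a HW]
    by (intro mult_right_mono) auto
  finally show "\<bar>a t - flow q p lam t s x0\<bar> \<le> k * (1 + C / \<epsilon>) * exp (- \<beta> * (t - s)) * \<bar>a s - x0\<bar>"
    using est(2) by (simp add: ac_simps)
qed

lemma repulsion_from_below:
  assumes r: "global_solution q p lam r" and rep: "repulsive_pair q r k \<beta>"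
    and le: "x0 \<le> r s" "t \<le> s"
  shows "\<bar>r t - flow q p lam t s x0\<bar> \<le> k * exp (\<beta> * (t - s)) * \<bar>r s - x0\<bar>"
proof -
  obtain H W where HW: "variation q r H W" using variation_exists[OF r] .
  have "0 \<le> (x0 - r s) * exp (- H s) * (W t - W s)"
    using variation_mono[OF HW \<open>t \<le> s\<close>] \<open>x0 \<le> r s\<close> by (simp add: mult_nonpos_nonpos mult_nonpos_nonneg)
  then have "\<bar>r t - flow q p lam t s x0\<bar> \<le> exp (H t - H s) * \<bar>r s - x0\<bar> / 1"
    by (intro flow_estimate[OF r HW]) auto
  also have "\<dots> = exp (H t - H s) * \<bar>r s - x0\<bar>" by simp
  also have "\<dots> \<le> k * exp (\<beta> * (t - s)) * \<bar>r s - x0\<bar>"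
    using rep \<open>t \<le> s\<close> unfolding repulsive_pair_iff[OF r HW] by (intro mult_right_mono) auto
  finally show ?thesis .
qed

lemma repulsion_below_attractor:
  assumes a: "global_solution q p lam a" and r: "global_solution q p lam r"
    and less: "\<And>t. r t < a t" and gap: "\<And>t. a t - r t \<le> C"
    and rep: "repulsive_pair q r k \<beta>"
    and eps: "\<epsilon> > 0" "x0 \<le> a s - \<epsilon>" "t \<le> s"
  shows "t \<in> max_interval q p lam s x0"
    and "\<bar>r t - flow q p lam t s x0\<bar> \<le> k * (1 + C / \<epsilon>) * exp (\<beta> * (t - s)) * \<bar>r s - x0\<bar>"
proof -
  interpret R: riccati "\<lambda>t. - q (- t)" "\<lambda>t. p (- t)" Q P by (rule reversed)
  have "attractive_pair (\<lambda>t. - q (- t)) (\<lambda>t. - r (- t)) k \<beta>"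
    using rep by (simp add: repulsive_pair_reversed[OF r])
  then have est: "- t \<in> max_interval (\<lambda>t. - q (- t)) (\<lambda>t. p (- t)) lam (- s) (- x0)"
    "\<bar>- r (- (- t)) - flow (\<lambda>t. - q (- t)) (\<lambda>t. p (- t)) lam (- t) (- s) (- x0)\<bar>
      \<le> k * (1 + C / \<epsilon>) * exp (- \<beta> * (- t - - s)) * \<bar>- r (- (- s)) - - x0\<bar>"
    using R.attraction_above_repeller[OF global_solution_reversed[OF r] global_solution_reversed[OF a],
        of C k \<beta> \<epsilon> "- s" "- x0" "- t"] less gap eps by auto
  note rev = R.flow_reversed[OF est(1)]
  show "t \<in> max_interval q p lam s x0" using rev(1) by simp
  have "flow q p lam t s x0 = - flow (\<lambda>t. - q (- t)) (\<lambda>t. p (- t)) lam (- t) (- s) (- x0)"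
    using rev(2) by simp
  moreover have "exp (- \<beta> * (- t - - s)) = exp (\<beta> * (t - s))" by (simp add: algebra_simps)
  ultimately show "\<bar>r t - flow q p lam t s x0\<bar> \<le> k * (1 + C / \<epsilon>) * exp (\<beta> * (t - s)) * \<bar>r s - x0\<bar>"
    using est(2) by (simp add: abs_minus_commute)
qed

lemma bounded_past_iff:
  assumes less: "\<And>t. r t < upper_sol q p lam t" and r: "global_solution q p lam r"
    and rep: "repulsive_pair q r k \<beta>"
  shows "bounded_past q p lam s x0 \<longleftrightarrow> x0 \<le> upper_sol q p lam s"
proof
  assume "bounded_past q p lam s x0"
  then have "{..s} \<subseteq> max_interval q p lam s x0" "bdd_above ((\<lambda>t. flow q p lam t s x0) ` {..s})"
    by (auto simp: bounded_past_def bounded_imp_bdd_above)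
  then have "bdd_above ((\<lambda>t. flow q p lam t s x0) ` (max_interval q p lam s x0 \<inter> {..s}))"
    by (simp add: Int_absorb1)
  then show "x0 \<le> upper_sol q p lam s" by (rule upper_sol_maximal(3)[OF r])
next
  define a where "a = upper_sol q p lam"
  define M where "M = 2 * (Q + P + \<bar>lam\<bar>) + 1"
  have a: "global_solution q p lam a" using upper_sol_maximal(1)[OF r] by (simp add: a_def)
  have aM: "\<bar>a t\<bar> \<le> M" and rM: "\<bar>r t\<bar> \<le> M" for t
    using global_solution_bound[OF a] global_solution_bound[OF r] by (auto simp: M_def)
  assume "x0 \<le> upper_sol q p lam s"
  then have "x0 \<le> a s" by (simp add: a_def)
  show "bounded_past q p lam s x0"
  proof (cases "x0 = a s")
    case True
    then show ?thesis
      using global_solution_flow[OF a] aM by (auto simp: bounded_past_def intro!: boundedI[of _ M])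
  next
    case False
    define \<epsilon> where "\<epsilon> = a s - x0"
    have eps: "\<epsilon> > 0" "x0 \<le> a s - \<epsilon>" using False \<open>x0 \<le> a s\<close> by (auto simp: \<epsilon>_def)
    have gap: "a t - r t \<le> 2 * M" for t using aM[of t] rM[of t] by linarith
    note est = repulsion_below_attractor[OF a r less[folded a_def] gap rep eps]
    have k: "k \<ge> 1" "\<beta> > 0" using rep by (auto simp: repulsive_pair_def)
    have M: "M \<ge> 0" using aM[of 0] by linarith
    have "\<bar>flow q p lam t s x0\<bar> \<le> M + k * (1 + 2 * M / \<epsilon>) * 1 * \<bar>r s - x0\<bar>" if "t \<le> s" for t
    proof -
      have "exp (\<beta> * (t - s)) \<le> 1" using k that by (simp add: mult_nonneg_nonpos)
      then have "k * (1 + 2 * M / \<epsilon>) * exp (\<beta> * (t - s)) * \<bar>r s - x0\<bar>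
          \<le> k * (1 + 2 * M / \<epsilon>) * 1 * \<bar>r s - x0\<bar>"
        using k eps M by (intro mult_right_mono mult_left_mono) auto
      then show ?thesis using est(2)[OF that] rM[of t] by linarith
    qed
    then have "bounded ((\<lambda>t. flow q p lam t s x0) ` {..s})"
      by (intro boundedI[of _ "M + k * (1 + 2 * M / \<epsilon>) * 1 * \<bar>r s - x0\<bar>"]) auto
    then show ?thesis using est(1) by (auto simp: bounded_past_def)
  qed
qed

lemma bounded_future_iff:
  assumes less: "\<And>t. lower_sol q p lam t < a t" and a: "global_solution q p lam a"
    and att: "attractive_pair q a k \<beta>"
  shows "bounded_future q p lam s x0 \<longleftrightarrow> lower_sol q p lam s \<le> x0"
proof
  assume "bounded_future q p lam s x0"
  then have "{s..} \<subseteq> max_interval q p lam s x0" "bdd_below ((\<lambda>t. flow q p lam t s x0) ` {s..})"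
    by (auto simp: bounded_future_def bounded_imp_bdd_below)
  then have "bdd_below ((\<lambda>t. flow q p lam t s x0) ` (max_interval q p lam s x0 \<inter> {s..}))"
    by (simp add: Int_absorb1)
  then show "lower_sol q p lam s \<le> x0" by (rule lower_sol_minimal(3)[OF a])
next
  define r where "r = lower_sol q p lam"
  define M where "M = 2 * (Q + P + \<bar>lam\<bar>) + 1"
  have r: "global_solution q p lam r" using lower_sol_minimal(1)[OF a] by (simp add: r_def)
  have aM: "\<bar>a t\<bar> \<le> M" and rM: "\<bar>r t\<bar> \<le> M" for t
    using global_solution_bound[OF a] global_solution_bound[OF r] by (auto simp: M_def)
  assume "lower_sol q p lam s \<le> x0"
  then have "r s \<le> x0" by (simp add: r_def)
  show "bounded_future q p lam s x0"
  proof (cases "x0 = r s")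
    case True
    then show ?thesis
      using global_solution_flow[OF r] rM by (auto simp: bounded_future_def intro!: boundedI[of _ M])
  next
    case False
    define \<epsilon> where "\<epsilon> = x0 - r s"
    have eps: "\<epsilon> > 0" "r s + \<epsilon> \<le> x0" using False \<open>r s \<le> x0\<close> by (auto simp: \<epsilon>_def)
    have gap: "a t - r t \<le> 2 * M" for t using aM[of t] rM[of t] by linarith
    note est = attraction_above_repeller[OF a r less[folded r_def] gap att eps]
    have k: "k \<ge> 1" "\<beta> > 0" using att by (auto simp: attractive_pair_def)
    have M: "M \<ge> 0" using aM[of 0] by linarith
    have "\<bar>flow q p lam t s x0\<bar> \<le> M + k * (1 + 2 * M / \<epsilon>) * 1 * \<bar>a s - x0\<bar>" if "s \<le> t" for t
    proof -
      have "exp (- \<beta> * (t - s)) \<le> 1" using k that by simp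
      then have "k * (1 + 2 * M / \<epsilon>) * exp (- \<beta> * (t - s)) * \<bar>a s - x0\<bar>
          \<le> k * (1 + 2 * M / \<epsilon>) * 1 * \<bar>a s - x0\<bar>"
        using k eps M by (intro mult_right_mono mult_left_mono) auto
      then show ?thesis using est(2)[OF that] aM[of t] by linarith
    qed
    then have "bounded ((\<lambda>t. flow q p lam t s x0) ` {s..})"
      by (intro boundedI[of _ "M + k * (1 + 2 * M / \<epsilon>) * 1 * \<bar>a s - x0\<bar>"]) auto
    then show ?thesis using est(1) by (auto simp: bounded_future_def)
  qed
qed

text \<open>Separated solutions do not cross, so the upper one is attractive and the lower one is repulsive. There is only
one attractive and one repulsive solution.\<close>

lemma separated_solutions_eq:
  assumes b: "global_solution q p lam b" and c: "global_solution q p lam c"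
    and sep: "uniformly_separated b c"
  shows "b = upper_sol q p lam \<and> c = lower_sol q p lam \<or> b = lower_sol q p lam \<and> c = upper_sol q p lam"
proof -
  define \<delta> where "\<delta> = (INF t. \<bar>b t - c t\<bar>)"
  have \<delta>: "\<delta> > 0" using sep by (simp add: \<delta>_def uniformly_separated_def)
  have le: "\<delta> \<le> \<bar>b t - c t\<bar>" for t
    unfolding \<delta>_def by (intro cINF_lower bdd_belowI2[where m = 0]) auto
  have *: "x = lower_sol q p lam \<and> y = upper_sol q p lam"
    if x: "global_solution q p lam x" and y: "global_solution q p lam y"
      and le: "\<And>t. \<delta> \<le> \<bar>x t - y t\<bar>" and less: "x 0 < y 0" for x y
  proof -
    have pos: "0 < y t - x t" for t
    proof (rule ccontr)
      assume "\<not> 0 < y t - x t"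
      then have "\<exists>u. y u - x u = 0"
        using less IVT'[of "\<lambda>u. y u - x u" t 0 0] IVT2'[of "\<lambda>u. y u - x u" t 0 0]
          continuous_on_diff[OF global_solution_continuous[OF y] global_solution_continuous[OF x]]
        by (cases "t \<le> 0") auto
      then show False using le \<delta> by (metis abs_minus_commute abs_zero not_less)
    qed
    have "x t + \<delta> \<le> y t" for t using le[of t] pos[of t] by linarith
    from separated_solution_attractive[OF x y \<delta> this] separated_solution_repulsive[OF x y \<delta> this]
    show ?thesis
      using attractive_eq_upper_sol[OF y] repulsive_eq_lower_sol[OF x] by blast
  qed
  have "b 0 \<noteq> c 0" using le[of 0] \<delta> by auto
  then show ?thesis
    using *[OF b c le] *[OF c b] le by (metis abs_minus_commute linorder_neqE)
qed

section \<open>The bifurcation value\<close>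

lemma solution_above:
  assumes "global_solution q p lam x" "lam \<le> lam'"
  shows "\<exists>x. global_solution q p lam' x"
  using assms upper_sol_strict_mono(1)[of lam x lam'] by (cases "lam = lam'") auto

lemma solution_at_sup_norm:
  assumes "bounded (range p)"
  shows "\<exists>x. global_solution q p (sup_norm p) x"
proof -
  have "(0::real)\<^sup>2 \<le> q t * 0 + p t + sup_norm p" for t
    using abs_le_sup_norm[OF assms, of t] by simp
  from constant_below_upper_sol(1)[OF _ this] show ?thesis by auto
qed

text \<open>Completing the square, \<open>x' = - (x - q / 2)\<^sup>2 + q\<^sup>2 / 4 + p + lam\<close>. If \<open>q\<^sup>2 / 4 + p + lam\<close> is bounded above by
a negative number, then \<open>x\<close> decreases at least linearly and is unbounded.\<close>

lemma parameter_lower_bound: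
  assumes x: "global_solution q p lam x"
  shows "- sup_norm (\<lambda>t. (q t)\<^sup>2 / 4 + p t) \<le> lam"
proof (rule ccontr)
  define S where "S = sup_norm (\<lambda>t. (q t)\<^sup>2 / 4 + p t)"
  define M where "M = 2 * (Q + P + \<bar>lam\<bar>) + 1"
  assume "\<not> - sup_norm (\<lambda>t. (q t)\<^sup>2 / 4 + p t) \<le> lam"
  then have neg: "S + lam < 0" by (simp add: S_def)
  have S: "(q t)\<^sup>2 / 4 + p t \<le> S" for t
  proof -
    have "\<bar>(q t)\<^sup>2 / 4 + p t\<bar> \<le> Q\<^sup>2 / 4 + P" for t
    proof -
      have "(q t)\<^sup>2 \<le> Q\<^sup>2" using q_bound[of t] by (metis abs_ge_zero power2_abs power_mono)
      moreover have "0 \<le> (q t)\<^sup>2" by simp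
      ultimately show ?thesis using p_bound[of t] by linarith
    qed
    then have "bounded (range (\<lambda>t. (q t)\<^sup>2 / 4 + p t))"
      by (intro boundedI[of _ "Q\<^sup>2 / 4 + P"]) auto
    from abs_le_sup_norm[OF this, of t] show ?thesis by (simp add: S_def)
  qed
  \<comment> \<open>the time in which \<open>x\<close> would fall by more than the length \<open>2 M\<close> of its range\<close>
  define T where "T = (2 * M + 1) / - (S + lam)"
  have xM: "\<bar>x t\<bar> \<le> M" for t using global_solution_bound[OF x] by (simp add: M_def)
  have T: "T \<ge> 0" "(S + lam) * T = - (2 * M + 1)"
    using neg xM[of 0] by (auto simp: T_def field_simps)
  have "x T - (S + lam) * T \<le> x 0 - (S + lam) * 0"
  proof (rule DERIV_nonpos_imp_nonincreasing[where f = "\<lambda>t. x t - (S + lam) * t", OF T(1)])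
    fix u
    have "((\<lambda>t. x t - (S + lam) * t) has_real_derivative
        - (x u)\<^sup>2 + q u * x u + p u + lam - (S + lam) * 1) (at u)"
      using x unfolding global_solution_iff by (intro DERIV_diff DERIV_cmult DERIV_ident) auto
    moreover have "- (x u)\<^sup>2 + q u * x u + p u + lam - (S + lam) * 1
        = (q u)\<^sup>2 / 4 + p u - S - (x u - q u / 2)\<^sup>2"
      by (simp add: power2_eq_square field_simps)
    moreover have "(q u)\<^sup>2 / 4 + p u - S - (x u - q u / 2)\<^sup>2 \<le> 0"
      using S[of u] zero_le_power2[of "x u - q u / 2"] by linarith
    ultimately show "\<exists>y. ((\<lambda>t. x t - (S + lam) * t) has_real_derivative y) (at u) \<and> y \<le> 0"
      by auto
  qed
  then show False using T xM[of T] xM[of 0] by linarith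
qed

definition threshold :: real where
  "threshold = Inf {lam. \<exists>x. global_solution q p lam x}"

text \<open>The admissible parameters form a half-line by monotonicity, and \<open>solution_at_infimum\<close> shows that it is closed.\<close>

lemma global_solution_iff_threshold:
  assumes "bounded (range p)"
  shows "(\<exists>x. global_solution q p lam x) \<longleftrightarrow> threshold \<le> lam"
proof -
  let ?S = "{lam. \<exists>x. global_solution q p lam x}"
  have ne: "?S \<noteq> {}" using solution_at_sup_norm[OF assms] by blast
  have bdd: "bdd_below ?S" using parameter_lower_bound by (auto simp: bdd_below_def)
  have above: "\<exists>x. global_solution q p lam' x" if less: "threshold < lam'" for lam'
  proof -
    obtain lam x where "global_solution q p lam x" "lam < lam'"
      using less cInf_lessD[OF ne, of lam'] unfolding threshold_def by auto
    then show ?thesis using solution_above[of lam x lam'] by simp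
  qed
  show ?thesis
  proof
    assume "\<exists>x. global_solution q p lam x"
    then show "threshold \<le> lam" unfolding threshold_def using bdd by (intro cInf_lower) auto
  next
    assume "threshold \<le> lam"
    then show "\<exists>x. global_solution q p lam x"
      using above solution_at_infimum[of lam] by force
  qed
qed

text \<open>Below \<open>a\<close> the formula based on \<open>a\<close> has no pole in the past, and above \<open>r\<close> the one based on \<open>r\<close> has no pole
in the future.\<close>

lemma bounded_orbits_between:
  assumes x: "global_solution q p lam x"
    and between: "lower_sol q p lam s \<le> x0" "x0 \<le> upper_sol q p lam s"
  shows "(s, x0) \<in> bounded_orbits q p lam"
proof -
  define a r where "a = upper_sol q p lam" and "r = lower_sol q p lam"
  have a: "global_solution q p lam a" and r: "global_solution q p lam r"
    using upper_sol_maximal(1)[OF x] lower_sol_minimal(1)[OF x] by (auto simp: a_def r_def)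
  have "t \<in> max_interval q p lam s x0" for t
  proof (cases "t \<le> s")
    case True
    obtain H W where HW: "variation q a H W" using variation_exists[OF a] .
    have "0 \<le> (x0 - a s) * exp (- H s) * (W t - W s)"
      using variation_mono[OF HW True] between by (simp add: a_def mult_nonpos_nonpos mult_nonpos_nonneg)
    then show ?thesis by (intro flow_from_known_solution(1)[OF a HW]) auto
  next
    case False
    then have "s \<le> t" by simp
    obtain H W where HW: "variation q r H W" using variation_exists[OF r] .
    have "0 \<le> (x0 - r s) * exp (- H s) * (W t - W s)"
      using variation_mono[OF HW \<open>s \<le> t\<close>] between by (simp add: r_def)
    then show ?thesis by (intro flow_from_known_solution(1)[OF r HW]) auto
  qed
  then have "max_interval q p lam s x0 = UNIV" by auto
  from global_solution_of_max_interval[OF this]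
  show ?thesis unfolding bounded_orbits_iff by blast
qed

lemma bounded_orbits_eq:
  assumes x: "global_solution q p lam x"
  shows "bounded_orbits q p lam = {(s, x0). lower_sol q p lam s \<le> x0 \<and> x0 \<le> upper_sol q p lam s}"
proof -
  have "lower_sol q p lam s \<le> x0 \<and> x0 \<le> upper_sol q p lam s"
    if "(s, x0) \<in> bounded_orbits q p lam" for s x0
    using that upper_sol_maximal(2)[OF x, of _ s] lower_sol_minimal(2)[OF x, of _ s]
    unfolding bounded_orbits_iff by blast
  then show ?thesis using bounded_orbits_between[OF x] by auto
qed

lemma extremal_solutions_separated:
  assumes "global_solution q p lam1 x" "lam1 < lam2"
  shows "\<exists>\<delta>>0. \<forall>t. lower_sol q p lam2 t + \<delta> \<le> upper_sol q p lam2 t"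
proof -
  obtain \<eta>1 where \<eta>1: "\<eta>1 > 0" "\<And>t. x t + \<eta>1 \<le> upper_sol q p lam2 t"
    using upper_sol_strict_mono(2)[OF assms] by blast
  obtain \<eta>2 where \<eta>2: "\<eta>2 > 0" "\<And>t. lower_sol q p lam2 t \<le> x t - \<eta>2"
    using lower_sol_strict_mono[OF assms] by blast
  have "lower_sol q p lam2 t + (\<eta>1 + \<eta>2) \<le> upper_sol q p lam2 t" for t
    using \<eta>1(2)[of t] \<eta>2(2)[of t] by linarith
  then show ?thesis using \<eta>1(1) \<eta>2(1) by (intro exI[of _ "\<eta>1 + \<eta>2"]) auto
qed

lemma lower_le_upper:
  assumes "global_solution q p lam x"
  shows "lower_sol q p lam t \<le> upper_sol q p lam t"
  using upper_sol_maximal(2)[OF assms assms] lower_sol_minimal(2)[OF assms assms] by (rule order_trans[rotated])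

lemma bounded_orbits_strict_mono:
  assumes x: "global_solution q p lam1 x" and "lam1 < lam2"
  shows "bounded_orbits q p lam1 \<subset> bounded_orbits q p lam2"
    and "lower_sol q p lam2 t < lower_sol q p lam1 t"
    and "upper_sol q p lam1 t < upper_sol q p lam2 t"
proof -
  obtain \<eta>1 where \<eta>1: "\<eta>1 > 0" "\<And>t. upper_sol q p lam1 t + \<eta>1 \<le> upper_sol q p lam2 t"
    using upper_sol_strict_mono(2)[OF upper_sol_maximal(1)[OF x] \<open>lam1 < lam2\<close>] by blast
  obtain \<eta>2 where \<eta>2: "\<eta>2 > 0" "\<And>t. lower_sol q p lam2 t \<le> lower_sol q p lam1 t - \<eta>2"
    using lower_sol_strict_mono[OF lower_sol_minimal(1)[OF x] \<open>lam1 < lam2\<close>] by blast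
  have less: "upper_sol q p lam1 t < upper_sol q p lam2 t"
    "lower_sol q p lam2 t < lower_sol q p lam1 t" for t
    using \<eta>1(1) \<eta>1(2)[of t] \<eta>2(1) \<eta>2(2)[of t] by linarith+
  show "upper_sol q p lam1 t < upper_sol q p lam2 t" "lower_sol q p lam2 t < lower_sol q p lam1 t"
    by (fact less)+
  have x2: "global_solution q p lam2 (upper_sol q p lam2)" by (rule upper_sol_strict_mono(1)[OF assms])
  have "bounded_orbits q p lam1 \<subseteq> bounded_orbits q p lam2"
  proof -
    have "lower_sol q p lam2 s \<le> x0 \<and> x0 \<le> upper_sol q p lam2 s"
      if "lower_sol q p lam1 s \<le> x0" "x0 \<le> upper_sol q p lam1 s" for s x0
      using less[of s] that by linarith
    then show ?thesis unfolding bounded_orbits_eq[OF x] bounded_orbits_eq[OF x2] by auto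
  qed
  moreover have "(0, upper_sol q p lam2 0) \<in> bounded_orbits q p lam2"
    using lower_le_upper[OF x2] by (simp add: bounded_orbits_eq[OF x2])
  moreover have "(0, upper_sol q p lam2 0) \<notin> bounded_orbits q p lam1"
    using less(1)[of 0] by (simp add: bounded_orbits_eq[OF x] not_le)
  ultimately show "bounded_orbits q p lam1 \<subset> bounded_orbits q p lam2" by blast
qed

lemma no_solution_below_imp_no_gap:
  assumes x: "global_solution q p lam x"
    and below: "\<And>lam' y. lam' < lam \<Longrightarrow> \<not> global_solution q p lam' y"
  shows "(INF t. upper_sol q p lam t - lower_sol q p lam t) = 0"
proof -
  define \<delta> where "\<delta> = (INF t. upper_sol q p lam t - lower_sol q p lam t)"
  have nonneg: "0 \<le> upper_sol q p lam t - lower_sol q p lam t" for t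
    using lower_le_upper[OF x, of t] by simp
  have "\<delta> \<ge> 0" unfolding \<delta>_def using nonneg by (intro cINF_greatest) auto
  moreover have "\<not> \<delta> > 0"
  proof
    assume "\<delta> > 0"
    have "\<delta> \<le> upper_sol q p lam t - lower_sol q p lam t" for t
      unfolding \<delta>_def using nonneg by (intro cINF_lower bdd_belowI2[where m = 0]) auto
    then have "lower_sol q p lam t + \<delta> \<le> upper_sol q p lam t" for t
      by (simp add: algebra_simps)
    from solution_from_separated_pair[OF lower_sol_minimal(1)[OF x] upper_sol_maximal(1)[OF x]
        \<open>\<delta> > 0\<close> this]
    show False using below[of "lam - \<delta>\<^sup>2 / 4"] \<open>\<delta> > 0\<close> by auto
  qed
  ultimately show ?thesis unfolding \<delta>_def by linarith
qed

end

lemma solves_on_shift: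
  "solves_on q (\<lambda>t. p t + c) lam = solves_on q p (lam + c)"
  by (intro ext) (simp add: solves_on_def algebra_simps)

lemma bounded_orbits_shift:
  "bounded_orbits q (\<lambda>t. p t + c) lam = bounded_orbits q p (lam + c)"
  by (simp add: bounded_orbits_def max_interval_def flow_def solves_on_shift)

lemma lambda_star_eqI:
  assumes "\<And>lam. bounded_orbits q p lam = {} \<longleftrightarrow> lam < L"
  shows "lambda_star q p = L"
  unfolding lambda_star_def
proof (rule the_equality)
  fix L' assume "\<forall>lam. bounded_orbits q p lam = {} \<longleftrightarrow> lam < L'"
  then have "lam < L' \<longleftrightarrow> lam < L" for lam using assms by simp
  then show "L' = L" by (meson linorder_neqE less_irrefl)
qed (use assms in blast)

theorem theorem3p6:
  fixes q p :: "real \<Rightarrow> real"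
  assumes "bounded (range q)" and "uniformly_continuous_on UNIV q"
    and "bounded (range p)" and "uniformly_continuous_on UNIV p"
  shows "\<exists>!L. L \<in> {- sup_norm (\<lambda>t. (q t)\<^sup>2 / 4 + p t) .. sup_norm p} \<and>
     \<comment> \<open>(i)\<close>
     (\<forall>lam. bounded_orbits q p lam = {} \<longleftrightarrow> lam < L) \<and>
     \<comment> \<open>(ii)\<close>
     (\<forall>lam1 lam2. L \<le> lam1 \<and> lam1 < lam2 \<longrightarrow>
        bounded_orbits q p lam1 \<subset> bounded_orbits q p lam2 \<and>
        (\<forall>t. lower_sol q p lam2 t < lower_sol q p lam1 t \<and>
             lower_sol q p lam1 t \<le> upper_sol q p lam1 t \<and>
             upper_sol q p lam1 t < upper_sol q p lam2 t)) \<and>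
     (\<forall>M. eventually (\<lambda>lam. \<forall>t. upper_sol q p lam t > M) at_top) \<and>
     (\<forall>M. eventually (\<lambda>lam. \<forall>t. lower_sol q p lam t < M) at_top) \<and>
     \<comment> \<open>(iii)\<close>
     (INF t. upper_sol q p L t - lower_sol q p L t) = 0 \<and>
     (\<nexists>b. hyperbolic q p L b) \<and>
     \<comment> \<open>(iv)\<close>
     (\<forall>lam > L.
        let a = upper_sol q p lam; r = lower_sol q p lam; x = flow q p lam in
        (INF t. a t - r t) > 0 \<and>
        (\<forall>b. hyperbolic q p lam b \<longleftrightarrow> b = a \<or> b = r) \<and>
        attractive_hyperbolic q p lam a \<and>
        repulsive_hyperbolic q p lam r \<and>
        (\<forall>s x0. bounded_past q p lam s x0 \<longleftrightarrow> x0 \<le> a s) \<and>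
        (\<forall>s x0. bounded_future q p lam s x0 \<longleftrightarrow> x0 \<ge> r s) \<and>
        (\<forall>b c. bounded_solution q p lam b \<and> bounded_solution q p lam c \<and> uniformly_separated b c
           \<longleftrightarrow> (b = a \<and> c = r) \<or> (b = r \<and> c = a)) \<and>
        (\<forall>ka \<beta>a kr \<beta>r. dichotomy_pair q a ka \<beta>a \<and> dichotomy_pair q r kr \<beta>r \<longrightarrow>
           (\<forall>\<gamma>a \<in> {0<..<\<beta>a}. \<forall>\<gamma>r \<in> {0<..<\<beta>r}. \<forall>\<epsilon> > 0. \<exists>kae \<ge> 1. \<exists>kre \<ge> 1.
              (\<forall>s t x0. x0 \<ge> r s + \<epsilon> \<and> t \<ge> s \<longrightarrow>
                 \<bar>a t - x t s x0\<bar> \<le> kae * exp (- \<gamma>a * (t - s)) * \<bar>a s - x0\<bar>) \<and>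
              (\<forall>s t x0. x0 \<le> a s - \<epsilon> \<and> t \<le> s \<longrightarrow>
                 \<bar>r t - x t s x0\<bar> \<le> kre * exp (\<gamma>r * (t - s)) * \<bar>r s - x0\<bar>)) \<and>
           (\<forall>s t x0. x0 \<ge> a s \<and> t \<ge> s \<longrightarrow>
              \<bar>a t - x t s x0\<bar> \<le> ka * exp (- \<beta>a * (t - s)) * \<bar>a s - x0\<bar>) \<and>
           (\<forall>s t x0. x0 \<le> r s \<and> t \<le> s \<longrightarrow>
              \<bar>r t - x t s x0\<bar> \<le> kr * exp (\<beta>r * (t - s)) * \<bar>r s - x0\<bar>))) \<and>
     \<comment> \<open>(v)\<close>
     (\<forall>c. lambda_star q (\<lambda>t. p t + c) = L - c)"
proof -
  obtain Q P where "\<And>t. \<bar>q t\<bar> \<le> Q" "\<And>t. \<bar>p t\<bar> \<le> P"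
    using assms(1,3) by (auto simp: bounded_iff)
  then interpret riccati q p Q P
    using assms(2,4) by unfold_locales (auto intro: uniformly_continuous_imp_continuous)
  define L where "L = threshold"
  have solvable: "(\<exists>x. global_solution q p lam x) \<longleftrightarrow> L \<le> lam" for lam
    unfolding L_def by (rule global_solution_iff_threshold[OF assms(3)])
  have empty: "bounded_orbits q p lam = {} \<longleftrightarrow> lam < L" for lam
    using solvable[of lam] by (auto simp: bounded_orbits_empty_iff)
  have unique: "L' = L" if "\<forall>lam. bounded_orbits q p lam = {} \<longleftrightarrow> lam < L'" for L'
    using that lambda_star_eqI[of q p L'] lambda_star_eqI[OF empty] by simp
  obtain xL where xL: "global_solution q p L xL" using solvable by blast
  have below: "\<not> global_solution q p lam y" if "lam < L" for lam y
    using solvable[of lam] that by auto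
  have iv: "let a = upper_sol q p lam; r = lower_sol q p lam; x = flow q p lam in
        (INF t. a t - r t) > 0 \<and>
        (\<forall>b. hyperbolic q p lam b \<longleftrightarrow> b = a \<or> b = r) \<and>
        attractive_hyperbolic q p lam a \<and>
        repulsive_hyperbolic q p lam r \<and>
        (\<forall>s x0. bounded_past q p lam s x0 \<longleftrightarrow> x0 \<le> a s) \<and>
        (\<forall>s x0. bounded_future q p lam s x0 \<longleftrightarrow> x0 \<ge> r s) \<and>
        (\<forall>b c. bounded_solution q p lam b \<and> bounded_solution q p lam c \<and> uniformly_separated b c
           \<longleftrightarrow> (b = a \<and> c = r) \<or> (b = r \<and> c = a)) \<and>
        (\<forall>ka \<beta>a kr \<beta>r. dichotomy_pair q a ka \<beta>a \<and> dichotomy_pair q r kr \<beta>r \<longrightarrow>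
           (\<forall>\<gamma>a \<in> {0<..<\<beta>a}. \<forall>\<gamma>r \<in> {0<..<\<beta>r}. \<forall>\<epsilon> > 0. \<exists>kae \<ge> 1. \<exists>kre \<ge> 1.
              (\<forall>s t x0. x0 \<ge> r s + \<epsilon> \<and> t \<ge> s \<longrightarrow>
                 \<bar>a t - x t s x0\<bar> \<le> kae * exp (- \<gamma>a * (t - s)) * \<bar>a s - x0\<bar>) \<and>
              (\<forall>s t x0. x0 \<le> a s - \<epsilon> \<and> t \<le> s \<longrightarrow>
                 \<bar>r t - x t s x0\<bar> \<le> kre * exp (\<gamma>r * (t - s)) * \<bar>r s - x0\<bar>)) \<and>
           (\<forall>s t x0. x0 \<ge> a s \<and> t \<ge> s \<longrightarrow>
              \<bar>a t - x t s x0\<bar> \<le> ka * exp (- \<beta>a * (t - s)) * \<bar>a s - x0\<bar>) \<and>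
           (\<forall>s t x0. x0 \<le> r s \<and> t \<le> s \<longrightarrow>
              \<bar>r t - x t s x0\<bar> \<le> kr * exp (\<beta>r * (t - s)) * \<bar>r s - x0\<bar>))"
    if lam: "L < lam" for lam
  proof -
    define a r where "a = upper_sol q p lam" and "r = lower_sol q p lam"
    define M where "M = 2 * (Q + P + \<bar>lam\<bar>) + 1"
    have a: "global_solution q p lam a"
      unfolding a_def by (rule upper_sol_strict_mono(1)[OF xL lam])
    have r: "global_solution q p lam r"
      unfolding r_def by (rule lower_sol_minimal(1)[OF a])
    obtain \<delta> where \<delta>: "\<delta> > 0" and sep: "\<And>t. r t + \<delta> \<le> a t"
      using extremal_solutions_separated[OF xL lam] by (auto simp: a_def r_def)
    have less: "r t < a t" for t using sep[of t] \<delta> by linarith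
    have gap: "a t - r t \<le> 2 * M" for t
      using global_solution_bound[OF a, of t] global_solution_bound[OF r, of t] by (auto simp: M_def)
    have M: "M > 0" using gap[of 0] less[of 0] by linarith
    obtain k where att: "attractive_pair q a k \<delta>"
      using separated_solution_attractive[OF r a \<delta> sep] by blast
    obtain k' where rep: "repulsive_pair q r k' \<delta>"
      using separated_solution_repulsive[OF r a \<delta> sep] by blast
    have "\<delta> \<le> (INF t. a t - r t)"
      using sep by (intro cINF_greatest) (auto simp: algebra_simps)
    then have inf: "(INF t. a t - r t) > 0" using \<delta> by linarith
    have hyp: "hyperbolic q p lam b \<longleftrightarrow> b = a \<or> b = r" for b
    proof
      assume "hyperbolic q p lam b"
      then show "b = a \<or> b = r"
        using attractive_eq_upper_sol repulsive_eq_lower_sol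
        unfolding hyperbolic_def dichotomy_pair_def a_def r_def by blast
    next
      assume "b = a \<or> b = r"
      then show "hyperbolic q p lam b"
        using a r att rep unfolding hyperbolic_def dichotomy_pair_def by blast
    qed
    have past: "bounded_past q p lam s x0 \<longleftrightarrow> x0 \<le> a s" for s x0
      unfolding a_def by (rule bounded_past_iff[OF less[unfolded a_def] r rep])
    have future: "bounded_future q p lam s x0 \<longleftrightarrow> r s \<le> x0" for s x0
      unfolding r_def by (rule bounded_future_iff[OF less[unfolded r_def] a att])
    have bounded_sol: "bounded_solution q p lam b \<longleftrightarrow> global_solution q p lam b" for b
      using global_solution_bound[of lam b]
      by (auto simp: bounded_solution_def bounded_iff)
    have "\<bar>a t - r t\<bar> = a t - r t" "\<bar>r t - a t\<bar> = a t - r t" for t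
      using less[of t] by auto
    then have us: "uniformly_separated a r" "uniformly_separated r a"
      using inf by (simp_all add: uniformly_separated_def)
    have usep: "bounded_solution q p lam b \<and> bounded_solution q p lam c \<and> uniformly_separated b c
        \<longleftrightarrow> (b = a \<and> c = r) \<or> (b = r \<and> c = a)" for b c
    proof
      assume "bounded_solution q p lam b \<and> bounded_solution q p lam c \<and> uniformly_separated b c"
      then show "(b = a \<and> c = r) \<or> (b = r \<and> c = a)"
        using separated_solutions_eq[of lam b c] by (simp add: bounded_sol a_def r_def)
    next
      assume "(b = a \<and> c = r) \<or> (b = r \<and> c = a)"
      then show "bounded_solution q p lam b \<and> bounded_solution q p lam c \<and> uniformly_separated b c"
        using us a r by (auto simp: bounded_sol)
    qed
    have est: "(\<forall>\<gamma>a \<in> {0<..<\<beta>a}. \<forall>\<gamma>r \<in> {0<..<\<beta>r}. \<forall>\<epsilon> > 0. \<exists>kae \<ge> 1. \<exists>kre \<ge> 1.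
              (\<forall>s t x0. x0 \<ge> r s + \<epsilon> \<and> t \<ge> s \<longrightarrow>
                 \<bar>a t - flow q p lam t s x0\<bar> \<le> kae * exp (- \<gamma>a * (t - s)) * \<bar>a s - x0\<bar>) \<and>
              (\<forall>s t x0. x0 \<le> a s - \<epsilon> \<and> t \<le> s \<longrightarrow>
                 \<bar>r t - flow q p lam t s x0\<bar> \<le> kre * exp (\<gamma>r * (t - s)) * \<bar>r s - x0\<bar>)) \<and>
           (\<forall>s t x0. x0 \<ge> a s \<and> t \<ge> s \<longrightarrow>
              \<bar>a t - flow q p lam t s x0\<bar> \<le> ka * exp (- \<beta>a * (t - s)) * \<bar>a s - x0\<bar>) \<and>
           (\<forall>s t x0. x0 \<le> r s \<and> t \<le> s \<longrightarrow>
              \<bar>r t - flow q p lam t s x0\<bar> \<le> kr * exp (\<beta>r * (t - s)) * \<bar>r s - x0\<bar>)"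
      if dich: "dichotomy_pair q a ka \<beta>a \<and> dichotomy_pair q r kr \<beta>r" for ka \<beta>a kr \<beta>r
    proof (intro conjI ballI allI impI)
      have atta: "attractive_pair q a ka \<beta>a"
        using dich not_attractive_and_repulsive[OF a att] by (auto simp: dichotomy_pair_def)
      have repr: "repulsive_pair q r kr \<beta>r"
        using dich not_attractive_and_repulsive[OF r _ rep] by (auto simp: dichotomy_pair_def)
      have k: "ka \<ge> 1" "kr \<ge> 1"
        using atta repr by (auto simp: attractive_pair_def repulsive_pair_def)
      show "\<bar>a t - flow q p lam t s x0\<bar> \<le> ka * exp (- \<beta>a * (t - s)) * \<bar>a s - x0\<bar>"
        if "x0 \<ge> a s \<and> t \<ge> s" for s t x0
        using attraction_from_above[OF a atta] that by blast
      show "\<bar>r t - flow q p lam t s x0\<bar> \<le> kr * exp (\<beta>r * (t - s)) * \<bar>r s - x0\<bar>"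
        if "x0 \<le> r s \<and> t \<le> s" for s t x0
        using repulsion_from_below[OF r repr] that by blast
      fix \<gamma>a \<gamma>r \<epsilon> :: real
      assume \<gamma>: "\<gamma>a \<in> {0<..<\<beta>a}" "\<gamma>r \<in> {0<..<\<beta>r}" and "\<epsilon> > 0"
      have "1 \<le> 1 + 2 * M / \<epsilon>" using M \<open>\<epsilon> > 0\<close> by simp
      then have C: "1 \<le> ka * (1 + 2 * M / \<epsilon>)" "1 \<le> kr * (1 + 2 * M / \<epsilon>)"
        using k mult_mono[of 1 ka 1 "1 + 2 * M / \<epsilon>"] mult_mono[of 1 kr 1 "1 + 2 * M / \<epsilon>"] by auto
      have "\<bar>a t - flow q p lam t s x0\<bar> \<le> ka * (1 + 2 * M / \<epsilon>) * exp (- \<gamma>a * (t - s)) * \<bar>a s - x0\<bar>"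
        if "x0 \<ge> r s + \<epsilon> \<and> t \<ge> s" for s t x0
      proof -
        have "- \<beta>a * (t - s) \<le> - \<gamma>a * (t - s)" using that \<gamma> by (intro mult_right_mono) auto
        then have "ka * (1 + 2 * M / \<epsilon>) * exp (- \<beta>a * (t - s)) * \<bar>a s - x0\<bar>
            \<le> ka * (1 + 2 * M / \<epsilon>) * exp (- \<gamma>a * (t - s)) * \<bar>a s - x0\<bar>"
          using C by (intro mult_right_mono mult_left_mono) auto
        then show ?thesis
          using attraction_above_repeller(2)[OF a r less gap atta \<open>\<epsilon> > 0\<close>, of s x0 t] that by linarith
      qed
      moreover have "\<bar>r t - flow q p lam t s x0\<bar> \<le> kr * (1 + 2 * M / \<epsilon>) * exp (\<gamma>r * (t - s)) * \<bar>r s - x0\<bar>"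
        if "x0 \<le> a s - \<epsilon> \<and> t \<le> s" for s t x0
      proof -
        have "\<beta>r * (t - s) \<le> \<gamma>r * (t - s)" using that \<gamma> by (intro mult_right_mono_neg) auto
        then have "kr * (1 + 2 * M / \<epsilon>) * exp (\<beta>r * (t - s)) * \<bar>r s - x0\<bar>
            \<le> kr * (1 + 2 * M / \<epsilon>) * exp (\<gamma>r * (t - s)) * \<bar>r s - x0\<bar>"
          using C by (intro mult_right_mono mult_left_mono) auto
        then show ?thesis
          using repulsion_below_attractor(2)[OF a r less gap repr \<open>\<epsilon> > 0\<close>, of x0 s t] that by linarith
      qed
      ultimately show "\<exists>kae \<ge> 1. \<exists>kre \<ge> 1.
              (\<forall>s t x0. x0 \<ge> r s + \<epsilon> \<and> t \<ge> s \<longrightarrow>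
                 \<bar>a t - flow q p lam t s x0\<bar> \<le> kae * exp (- \<gamma>a * (t - s)) * \<bar>a s - x0\<bar>) \<and>
              (\<forall>s t x0. x0 \<le> a s - \<epsilon> \<and> t \<le> s \<longrightarrow>
                 \<bar>r t - flow q p lam t s x0\<bar> \<le> kre * exp (\<gamma>r * (t - s)) * \<bar>r s - x0\<bar>)"
        using C by blast
    qed
    have "attractive_hyperbolic q p lam a" "repulsive_hyperbolic q p lam r"
      using a r att rep unfolding attractive_hyperbolic_def repulsive_hyperbolic_def by blast+
    then show ?thesis
      unfolding Let_def a_def[symmetric] r_def[symmetric]
      using inf hyp past future usep est by (intro conjI) blast+
  qed
  show ?thesis
  proof (rule ex1I[where a = L], intro conjI)
    show "L \<in> {- sup_norm (\<lambda>t. (q t)\<^sup>2 / 4 + p t) .. sup_norm p}"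
      using parameter_lower_bound[OF xL] solution_at_sup_norm[OF assms(3)] solvable by auto
    show "\<forall>lam. bounded_orbits q p lam = {} \<longleftrightarrow> lam < L" using empty by blast
    show "\<forall>lam1 lam2. L \<le> lam1 \<and> lam1 < lam2 \<longrightarrow>
        bounded_orbits q p lam1 \<subset> bounded_orbits q p lam2 \<and>
        (\<forall>t. lower_sol q p lam2 t < lower_sol q p lam1 t \<and>
             lower_sol q p lam1 t \<le> upper_sol q p lam1 t \<and>
             upper_sol q p lam1 t < upper_sol q p lam2 t)"
      using solvable bounded_orbits_strict_mono lower_le_upper by metis
    show "\<forall>M. eventually (\<lambda>lam. \<forall>t. upper_sol q p lam t > M) at_top"
    proof
      fix M
      show "eventually (\<lambda>lam. \<forall>t. upper_sol q p lam t > M) at_top"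
        using upper_sol_unbounded[of M] by eventually_elim blast
    qed
    show "\<forall>M. eventually (\<lambda>lam. \<forall>t. lower_sol q p lam t < M) at_top"
      using lower_sol_unbounded by blast
    show "(INF t. upper_sol q p L t - lower_sol q p L t) = 0"
      by (rule no_solution_below_imp_no_gap[OF xL below])
    show "\<nexists>b. hyperbolic q p L b"
    proof
      assume "\<exists>b. hyperbolic q p L b"
      then obtain \<eta> x where "\<eta> > 0" "global_solution q p (L - \<eta>) x"
        using solution_from_hyperbolic by blast
      then show False using below[of "L - \<eta>" x] by simp
    qed
    show "\<forall>c. lambda_star q (\<lambda>t. p t + c) = L - c"
      by (intro allI lambda_star_eqI) (auto simp: bounded_orbits_shift empty)
  qed (intro allI impI, erule iv, elim conjE, erule unique)
qed

end
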